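(* Let $n\geq 1$ be an integer and let $\psi\colon\mathbb{N}\to(0,\infty)$ be a non-increasing function such that $\psi(s)=o(s^{-\frac{n+1}{n}})$ as $s\to\infty$. Then $$\dim_H \mathbf{Bad}(\psi)=\dim_H W(\psi).$$
   Context: $\dim_H$ denotes Hausdorff dimension. $\mathbb{R}^n$ carries the norm $\|x\|=\max_{1\leq i\leq n}|x_i|$. For a non-increasing $\psi\colon\mathbb{N}\to(0,\infty)$, the set of $\psi$-approximable points is $$W(\psi)=\Big\{x\in\mathbb{R}^n : \text{there exist infinitely many rational points } \tfrac{p}{q}\in\mathbb{Q}^n \text{ with } \big\|x-\tfrac{p}{q}\big\|<\psi(q)\Big\},$$ where $p\in\mathbb{Z}^n$ and $q\geq 1$ is an integer. The set of $\psi$-badly approximable points is $$\mathbf{Bad}(\psi)=W(\psi)\setminus\bigcap_{c>0}W(c\psi).$$ *)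

theory Defs
  imports "HOL-Analysis.Analysis" "HOL-Library.Landau_Symbols"
begin

(* Hausdorff measure and dimension are taken with respect to an explicit distance d, because
   dist on real ^ 'n is the Euclidean distance, whereas here R^n carries the maximum norm. *)

definition diam :: "('a \<Rightarrow> 'a \<Rightarrow> real) \<Rightarrow> 'a set \<Rightarrow> real" where
  "diam d U = (if U = {} then 0 else SUP (x, y)\<in>U \<times> U. d x y)"

(* The s-th power of the diameter, with the convention 0^0 = 1 on nonempty sets, so that
   s = 0 gives counting measure; note that 0 powr 0 = 0. *)
definition diam_pow :: "('a \<Rightarrow> 'a \<Rightarrow> real) \<Rightarrow> real \<Rightarrow> 'a set \<Rightarrow> real" where
  "diam_pow d s U = (if U = {} then 0 else if s = 0 then 1 else diam d U powr s)"

(* Pairwise distances are bounded rather than diam itself, as diam is only meaningful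
   on bounded sets; finite covers are included since the U i may be empty. *)
definition delta_covers :: "('a \<Rightarrow> 'a \<Rightarrow> real) \<Rightarrow> real \<Rightarrow> 'a set \<Rightarrow> (nat \<Rightarrow> 'a set) set" where
  "delta_covers d \<delta> E = {U. E \<subseteq> (\<Union>i. U i) \<and> (\<forall>i. \<forall>x\<in>U i. \<forall>y\<in>U i. d x y \<le> \<delta>)}"

definition hausdorff_premeasure ::
    "('a \<Rightarrow> 'a \<Rightarrow> real) \<Rightarrow> real \<Rightarrow> real \<Rightarrow> 'a set \<Rightarrow> ennreal" where
  "hausdorff_premeasure d s \<delta> E = (INF U\<in>delta_covers d \<delta> E. \<Sum>i. ennreal (diam_pow d s (U i)))"

definition hausdorff_measure :: "('a \<Rightarrow> 'a \<Rightarrow> real) \<Rightarrow> real \<Rightarrow> 'a set \<Rightarrow> ennreal" where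
  "hausdorff_measure d s E = (SUP \<delta>\<in>{0<..}. hausdorff_premeasure d s \<delta> E)"

definition hausdorff_dim :: "('a \<Rightarrow> 'a \<Rightarrow> real) \<Rightarrow> 'a set \<Rightarrow> ennreal" where
  "hausdorff_dim d E = (INF s\<in>{s. 0 \<le> s \<and> hausdorff_measure d s E = 0}. ennreal s)"

(* By infnorm_Max, infnorm is the maximum of the absolute values of the coordinates. *)
definition max_dist :: "real ^ 'n \<Rightarrow> real ^ 'n \<Rightarrow> real" where
  "max_dist x y = infnorm (x - y)"

definition rat_point :: "int ^ 'n \<Rightarrow> nat \<Rightarrow> real ^ 'n" where
  "rat_point p q = (\<chi> i. real_of_int (p $ i) / real q)"

(* The set below consists of points p/q, not of pairs (p, q): a rational point counts once
   however many representations p/q it has. *)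
definition approximable :: "(nat \<Rightarrow> real) \<Rightarrow> (real ^ 'n) set" where
  "approximable \<psi> =
     {x. infinite {rat_point p q | p q. 1 \<le> q \<and> max_dist x (rat_point p q) < \<psi> q}}"

definition badly_approximable :: "(nat \<Rightarrow> real) \<Rightarrow> (real ^ 'n) set" where
  "badly_approximable \<psi> = approximable \<psi> - (\<Inter>c\<in>{0<..}. approximable (\<lambda>q. c * \<psi> q))"

end

theory Submission
  imports Defs
begin

text \<open>
  Only the lower bound for \<open>Bad(\<psi>)\<close> needs work. If \<open>q ^ (n + 1) * \<psi>(q) ^ s\<close> is bounded, the
  natural cover shows that \<open>W(\<psi>)\<close> has dimension at most \<open>s\<close>; so for \<open>s < dim W(\<psi>)\<close> this
  quantity is unbounded and has arbitrarily large record values \<open>Q\<close>.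

  In a ball of radius \<open>r\<close> all rational points with denominator below a multiple of
  \<open>r powr (- n / (n + 1))\<close> lie on one hyperplane (pigeonhole), so a family of
  \<open>N ^ n\<close> separated balls of radius \<open>r / (16 N)\<close> stays away from all of them. Iterating this
  gives a Cantor set of almost full dimension that avoids all rational points. At sparse levels
  the current ball is instead replaced by the ball of radius \<open>\<psi>(Q) / 2\<close> around a rational point
  with denominator at most \<open>Q\<close>, which makes the limit points \<open>\<psi>\<close>-approximable.
  Monotonicity of \<open>\<psi>\<close> takes care of the denominators above \<open>Q\<close> that the hyperplane step
  after a jump removes only up to distance \<open>\<psi>(Q)\<close>; for those slightly below \<open>Q\<close> one uses that
  \<open>Q\<close> is a record. Base-\<open>N ^ n\<close> expansions parametrise the Cantor set by the unit interval, with
  a Hoelder continuous inverse.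
\<close>

section \<open>Rational points in small balls\<close>

lemma max_dist_le_iff: "max_dist x y \<le> r \<longleftrightarrow> (\<forall>i. \<bar>x $ i - y $ i\<bar> \<le> r)"
proof
  assume "max_dist x y \<le> r"
  then show "\<forall>i. \<bar>x $ i - y $ i\<bar> \<le> r"
    using component_le_infnorm_cart[of "x - y"] by (auto simp: max_dist_def intro: order_trans)
next
  assume "\<forall>i. \<bar>x $ i - y $ i\<bar> \<le> r"
  then show "max_dist x y \<le> r"
    unfolding max_dist_def infnorm_cart by (intro cSup_least) auto
qed

lemma component_le_max_dist: "\<bar>x $ i - y $ i\<bar> \<le> max_dist x y"
  using max_dist_le_iff[of x y "max_dist x y"] by blast

lemma max_dist_nonneg [simp]: "0 \<le> max_dist x y"
  by (simp add: max_dist_def infnorm_pos_le)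

lemma max_dist_self [simp]: "max_dist x x = 0"
  by (simp add: max_dist_def infnorm_0)

lemma max_dist_commute: "max_dist x y = max_dist y x"
  by (simp add: max_dist_def infnorm_sub)

lemma max_dist_triangle: "max_dist x z \<le> max_dist x y + max_dist y z"
  using infnorm_triangle[of "x - y" "y - z"] by (simp add: max_dist_def)

lemma compact_max_dist_ball: "compact {y. max_dist y z \<le> r}"
proof -
  have "{y. max_dist y z \<le> r} = cbox (z - vec r) (z + vec r)"
    by (auto simp: max_dist_le_iff mem_box_cart abs_le_iff algebra_simps)
  then show ?thesis by simp
qed

lemma rat_point_nth [simp]: "rat_point p q $ i = real_of_int (p $ i) / real q"
  by (simp add: rat_point_def)

text \<open>Pigeonhole: the \<open>(A + 1) ^ n\<close> integer vectors with entries in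
  \<open>{0..A}\<close> outnumber the \<open>A ^ n\<close> intervals of length
  \<open>1 / A ^ n\<close> that partition the unit interval. Two of them therefore give fractional
  parts of the linear form in the same interval, and \<open>a\<close> is their difference.\<close>

lemma dirichlet_linear_form:
  fixes x :: "real ^ 'n"
  assumes A: "1 \<le> A"
  obtains a :: "int ^ 'n" and b :: int where "a \<noteq> 0" "\<And>i. \<bar>a $ i\<bar> \<le> int A"
    "\<bar>(\<Sum>i\<in>UNIV. real_of_int (a $ i) * x $ i) + real_of_int b\<bar> < 1 / real A ^ CARD('n)"
proof -
  define n where "n = CARD('n)"
  define S where "S = (UNIV :: 'n set) \<rightarrow>\<^sub>E {0..int A}"
  define L where "L = (\<lambda>a :: 'n \<Rightarrow> int. \<Sum>i\<in>UNIV. real_of_int (a i) * x $ i)"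
  define \<phi> where "\<phi> = (\<lambda>a. \<lfloor>real A ^ n * frac (L a)\<rfloor>)"
  have Apos: "0 < real A ^ n" using A by simp
  have "\<phi> ` S \<subseteq> {0..<int A ^ n}"
  proof safe
    fix a
    have "real A ^ n * frac (L a) < real A ^ n * 1"
      using Apos frac_lt_1 by (intro mult_strict_left_mono) auto
    then show "\<phi> a \<in> {0..<int A ^ n}"
      using Apos by (auto simp: \<phi>_def floor_less_iff)
  qed
  then have "card (\<phi> ` S) \<le> card {0..<int A ^ n}"
    by (intro card_mono) auto
  also have "\<dots> = A ^ n" by (simp add: nat_power_eq)
  also have "\<dots> < (A + 1) ^ n"
    by (intro power_strict_mono) (auto simp: n_def)
  also have "\<dots> = card S"
    by (simp add: S_def card_funcsetE n_def nat_add_distrib)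
  finally have "\<not> inj_on \<phi> S" by (rule pigeonhole)
  then obtain a a' where a: "a \<in> S" "a' \<in> S" "a \<noteq> a'" "\<phi> a = \<phi> a'"
    by (auto simp: inj_on_def)
  have "\<bar>real A ^ n * frac (L a) - real A ^ n * frac (L a')\<bar> < 1"
    using a(4) unfolding \<phi>_def by linarith
  then have "real A ^ n * \<bar>frac (L a) - frac (L a')\<bar> < 1"
    using Apos by (metis abs_mult abs_of_pos right_diff_distrib)
  then have lt: "\<bar>frac (L a) - frac (L a')\<bar> < 1 / real A ^ n"
    using Apos by (simp add: field_simps)
  define c :: "int ^ 'n" where "c = (\<chi> i. a i - a' i)"
  define b where "b = \<lfloor>L a'\<rfloor> - \<lfloor>L a\<rfloor>"
  have "(\<Sum>i\<in>UNIV. real_of_int (c $ i) * x $ i) = L a - L a'"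
    by (simp add: c_def L_def algebra_simps sum_subtractf)
  then have "(\<Sum>i\<in>UNIV. real_of_int (c $ i) * x $ i) + real_of_int b = frac (L a) - frac (L a')"
    by (simp add: b_def frac_def)
  moreover have "c \<noteq> 0" using a(3) by (auto simp: c_def vec_eq_iff)
  moreover have "\<bar>c $ i\<bar> \<le> int A" for i
  proof -
    have "0 \<le> a i" "a i \<le> int A" "0 \<le> a' i" "a' i \<le> int A"
      using a(1,2) by (auto simp: S_def PiE_iff)
    then show ?thesis by (simp add: c_def)
  qed
  ultimately show ?thesis using that lt n_def by metis
qed

text \<open>The library theorem \<open>Dirichlet_approx_simult\<close> is indexed by
  \<open>{..<n}\<close>; a bijection carries it over to the coordinate type.\<close>

lemma dirichlet_simultaneous:
  fixes x :: "real ^ 'n"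
  assumes A: "1 \<le> A"
  obtains p :: "int ^ 'n" and q :: nat where "1 \<le> q" "q \<le> A ^ CARD('n)"
    "max_dist x (rat_point p q) < 1 / (real q * real A)"
proof -
  obtain e where e: "bij_betw e {..<CARD('n)} (UNIV :: 'n set)"
    using ex_bij_betw_nat_finite[of "UNIV :: 'n set"] by (auto simp: atLeast0LessThan)
  obtain q p where q: "0 < q" "q \<le> int (A ^ CARD('n))"
    and p: "\<And>i. i < CARD('n) \<Longrightarrow> \<bar>of_int q * x $ e i - of_int (p i)\<bar> < 1 / A"
    using Dirichlet_approx_simult[of A "CARD('n)" "\<lambda>i. x $ e i"] A by (metis less_eq_Suc_le One_nat_def)
  define e' where "e' = inv_into {..<CARD('n)} e"
  have e': "e' i < CARD('n)" "e (e' i) = i" for i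
    using e bij_betw_inv_into_right[OF e] bij_betwE[OF bij_betw_inv_into[OF e]]
    by (auto simp: e'_def)
  define P :: "int ^ 'n" where "P = (\<chi> i. p (e' i))"
  have q': "real (nat q) = of_int q" using q by simp
  have lt: "\<bar>x $ i - rat_point P (nat q) $ i\<bar> < 1 / (of_int q * real A)" for i
  proof -
    have "\<bar>x $ i - rat_point P (nat q) $ i\<bar> = \<bar>of_int q * x $ i - of_int (p (e' i))\<bar> / of_int q"
      using q by (simp add: P_def field_simps abs_divide flip: abs_of_pos)
    also have "\<dots> < (1 / A) / of_int q"
      using p[OF e'(1)[of i]] q e'(2)[of i] by (intro divide_strict_right_mono) auto
    finally show ?thesis by (simp add: mult.commute)
  qed
  \<comment> \<open>\<open>max_dist_le_iff\<close> handles only weak bounds; the maximum over the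
    finitely many coordinates keeps the inequality strict.\<close>
  define m where "m = Max (range (\<lambda>i. \<bar>x $ i - rat_point P (nat q) $ i\<bar>))"
  have "max_dist x (rat_point P (nat q)) \<le> m"
    unfolding max_dist_le_iff m_def by (auto intro: Max_ge)
  also have "m < 1 / (of_int q * real A)"
    unfolding m_def using lt by (subst Max_less_iff) auto
  finally have "max_dist x (rat_point P (nat q)) < 1 / (real (nat q) * real A)"
    using q' by simp
  moreover have "1 \<le> nat q" "nat q \<le> A ^ CARD('n)" using q by (auto simp: nat_le_iff)
  ultimately show ?thesis using that by blast
qed

text \<open>The bound \<open>q < r powr (- n / (n + 1)) / (2 * n + 1)\<close>, below which the rational points in a
  ball of radius \<open>r\<close> are confined to a hyperplane.\<close>
definition low_denominator :: "nat \<Rightarrow> real \<Rightarrow> nat \<Rightarrow> bool" where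
  "low_denominator n r q \<longleftrightarrow> (2 * real n + 1) * real q * root (Suc n) r ^ n < 1"

text \<open>Let \<open>h\<close> be the \<open>(n + 1)\<close>-st root of \<open>r\<close>.
  Dirichlet's theorem gives an integral affine form with coefficients at most \<open>2 / h\<close>
  and value below \<open>h ^ n\<close> at \<open>z\<close>; on the ball of radius \<open>r\<close>
  it varies by at most \<open>2 * n * h ^ n\<close>. At \<open>p / q\<close>, multiplication by
  \<open>q\<close> yields an integer of absolute value below 1.\<close>

lemma rationals_on_hyperplane:
  fixes z :: "real ^ 'n"
  assumes r: "0 < r" "r \<le> 1"
  obtains a :: "real ^ 'n" and b :: real where "a \<noteq> 0"
    "\<And>p q. \<lbrakk>1 \<le> q; low_denominator CARD('n) r q; max_dist (rat_point p q) z \<le> r\<rbrakk>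
       \<Longrightarrow> (\<Sum>i\<in>UNIV. a $ i * rat_point p q $ i) + b = 0"
proof -
  define n where "n = CARD('n)"
  define h where "h = root (Suc n) r"
  have h: "0 < h" "h \<le> 1" and rh: "r = h ^ Suc n"
    using r by (auto simp: h_def simp del: power_Suc)
  define A where "A = nat \<lceil>1 / h\<rceil>"
  have A1: "1 / h \<le> real A" unfolding A_def by linarith
  have "0 < 1 / h" using h by simp
  then have "real A \<le> 1 / h + 1" unfolding A_def by linarith
  also have "\<dots> \<le> 2 / h" using h by (simp add: field_simps)
  finally have A2: "real A \<le> 2 / h" .
  have A: "1 \<le> A" using A1 \<open>0 < 1 / h\<close> by (cases A) auto
  obtain a b where ab: "a \<noteq> 0" "\<And>i. \<bar>a $ i\<bar> \<le> int A"
    "\<bar>(\<Sum>i\<in>UNIV. real_of_int (a $ i) * z $ i) + real_of_int b\<bar> < 1 / real A ^ CARD('n)"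
    using dirichlet_linear_form[OF A, of z] by metis
  define a' :: "real ^ 'n" where "a' = (\<chi> i. real_of_int (a $ i))"
  have "a' \<noteq> 0" using ab(1) by (simp add: a'_def vec_eq_iff)
  moreover have "(\<Sum>i\<in>UNIV. a' $ i * rat_point p q $ i) + real_of_int b = 0"
    if q: "1 \<le> q" and low: "low_denominator CARD('n) r q" and near: "max_dist (rat_point p q) z \<le> r" for p q
  proof -
    define I where "I = (\<Sum>i\<in>UNIV. a $ i * p $ i) + b * int q"
    have I: "real_of_int I = real q * ((\<Sum>i\<in>UNIV. a' $ i * rat_point p q $ i) + real_of_int b)"
      using q by (simp add: I_def a'_def sum_distrib_left algebra_simps)
    have "\<bar>\<Sum>i\<in>UNIV. a' $ i * (rat_point p q $ i - z $ i)\<bar> \<le> (\<Sum>i\<in>(UNIV::'n set). real A * r)"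
    proof (rule order_trans[OF sum_abs sum_mono])
      fix i
      have "\<bar>a' $ i\<bar> \<le> real A" using ab(2)[of i] by (simp add: a'_def)
      moreover have "\<bar>rat_point p q $ i - z $ i\<bar> \<le> r" using near by (simp add: max_dist_le_iff)
      ultimately show "\<bar>a' $ i * (rat_point p q $ i - z $ i)\<bar> \<le> real A * r"
        unfolding abs_mult by (intro mult_mono) auto
    qed
    also have "\<dots> = n * (real A * r)" by (simp add: n_def)
    also have "\<dots> \<le> n * (2 / h * r)" using A2 r by (intro mult_left_mono mult_right_mono) auto
    also have "\<dots> = 2 * n * h ^ n" using h by (simp add: rh)
    finally have 1: "\<bar>\<Sum>i\<in>UNIV. a' $ i * (rat_point p q $ i - z $ i)\<bar> \<le> 2 * n * h ^ n" .
    have "1 / real A ^ n \<le> 1 / (1 / h) ^ n"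
      using h A1 A by (intro divide_left_mono power_mono mult_pos_pos) auto
    also have "\<dots> = h ^ n" by (simp add: power_divide)
    finally have "1 / real A ^ n \<le> h ^ n" .
    with ab(3) have 2: "\<bar>(\<Sum>i\<in>UNIV. a' $ i * z $ i) + real_of_int b\<bar> < h ^ n"
      by (simp add: a'_def n_def)
    have "(\<Sum>i\<in>UNIV. a' $ i * rat_point p q $ i) + real_of_int b
        = (\<Sum>i\<in>UNIV. a' $ i * (rat_point p q $ i - z $ i)) + ((\<Sum>i\<in>UNIV. a' $ i * z $ i) + real_of_int b)"
      by (simp add: algebra_simps sum_subtractf)
    with 1 2 have "\<bar>(\<Sum>i\<in>UNIV. a' $ i * rat_point p q $ i) + real_of_int b\<bar> < (2 * n + 1) * h ^ n"
      by (simp add: algebra_simps)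
    then have "\<bar>real_of_int I\<bar> < real q * ((2 * n + 1) * h ^ n)"
      unfolding I abs_mult using q by (simp add: mult_strict_left_mono)
    also have "\<dots> < 1"
      using low by (simp add: low_denominator_def h_def n_def mult_ac add_ac)
    finally have "I = 0" by linarith
    then show ?thesis using I q by simp
  qed
  ultimately show ?thesis using that by blast
qed

text \<open>The relevant rational points near \<open>z\<close> are zeros of an affine form
  \<open>F\<close> with Lipschitz constant \<open>S\<close>, the sum of the absolute values of its
  coefficients. Moving \<open>z\<close> by \<open>r / 2\<close> along the signs of the coefficients
  makes the modulus of \<open>F\<close> at least \<open>S * r / 2\<close>, so it is at least
  \<open>S * r / 4\<close> on the ball of radius \<open>r / 4\<close>, which forces distance
  \<open>r / 4\<close> from the zeros. Points farther than \<open>r\<close> from \<open>z\<close>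
  are harmless, since \<open>y\<close> lies within \<open>3 * r / 4\<close> of
  \<open>z\<close>.\<close>

lemma ex_ball_away_from_rationals:
  fixes z :: "real ^ 'n"
  assumes r: "0 < r" "r \<le> 1"
  obtains z' :: "real ^ 'n" where "max_dist z' z \<le> r / 2"
    "\<And>y p q. \<lbrakk>max_dist y z' \<le> r / 4; 1 \<le> q; low_denominator CARD('n) r q\<rbrakk>
       \<Longrightarrow> r / 4 \<le> max_dist y (rat_point p q)"
proof -
  obtain a :: "real ^ 'n" and b where a: "a \<noteq> 0"
    and hyp: "\<And>p q. \<lbrakk>1 \<le> q; low_denominator CARD('n) r q; max_dist (rat_point p q) z \<le> r\<rbrakk>
       \<Longrightarrow> (\<Sum>i\<in>UNIV. a $ i * rat_point p q $ i) + b = 0"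
    using rationals_on_hyperplane[OF r, of z] by metis
  define F where "F = (\<lambda>y :: real ^ 'n. (\<Sum>i\<in>UNIV. a $ i * y $ i) + b)"
  define S where "S = (\<Sum>i\<in>UNIV. \<bar>a $ i\<bar>)"
  have S: "0 < S"
  proof -
    obtain i where "a $ i \<noteq> 0" using a by (auto simp: vec_eq_iff)
    then show ?thesis unfolding S_def by (intro sum_pos2[of _ i]) auto
  qed
  have lip: "\<bar>F y - F y'\<bar> \<le> S * max_dist y y'" for y y'
  proof -
    have "\<bar>F y - F y'\<bar> = \<bar>\<Sum>i\<in>UNIV. a $ i * (y $ i - y' $ i)\<bar>"
      by (simp add: F_def algebra_simps sum_subtractf)
    also have "\<dots> \<le> (\<Sum>i\<in>UNIV. \<bar>a $ i\<bar> * max_dist y y')"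
      by (rule order_trans[OF sum_abs sum_mono])
        (auto simp: abs_mult intro!: mult_left_mono component_le_max_dist)
    finally show ?thesis by (simp add: S_def sum_distrib_right)
  qed
  \<comment> \<open>This is the sign of \<open>F z\<close>, so that the displacement adds to the
    modulus of \<open>F z\<close> instead of cancelling it.\<close>
  define \<epsilon> :: real where "\<epsilon> = (if 0 \<le> F z then 1 else -1)"
  define z' where "z' = (\<chi> i. z $ i + \<epsilon> * (r / 2) * sgn (a $ i))"
  have "F z' = F z + \<epsilon> * (r / 2) * S"
    by (simp add: F_def z'_def S_def algebra_simps sum.distrib sum_distrib_left abs_sgn sgn_if)
  then have Fz': "r / 2 * S \<le> \<bar>F z'\<bar>"
    using mult_pos_pos[OF S r(1)] by (auto simp: \<epsilon>_def abs_if algebra_simps)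
  have z'z: "max_dist z' z \<le> r / 2"
    unfolding max_dist_le_iff using r by (auto simp: z'_def \<epsilon>_def abs_mult sgn_if)
  have "r / 4 \<le> max_dist y (rat_point p q)"
    if y: "max_dist y z' \<le> r / 4" and q: "1 \<le> q" "low_denominator CARD('n) r q" for y p q
  proof (cases "max_dist (rat_point p q) z \<le> r")
    case True
    then have 0: "F (rat_point p q) = 0" using hyp[OF q, of p] by (simp add: F_def)
    have "\<bar>F y - F z'\<bar> \<le> S * (r / 4)"
      using lip[of y z'] mult_left_mono[OF y, of S] S by linarith
    moreover have "S * (r / 4) = r / 4 * S" "r / 2 * S = 2 * (r / 4 * S)" by simp_all
    ultimately have "r / 4 * S \<le> \<bar>F y\<bar>" using Fz' by linarith
    also have "\<bar>F y\<bar> \<le> S * max_dist y (rat_point p q)"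
      using lip[of y "rat_point p q"] 0 by simp
    finally show ?thesis using S by (simp add: mult.commute)
  next
    case False
    have "max_dist (rat_point p q) z \<le> max_dist (rat_point p q) y + (max_dist y z' + max_dist z' z)"
      using max_dist_triangle[of "rat_point p q" z y] max_dist_triangle[of y z z'] by linarith
    then show ?thesis using False y z'z max_dist_commute[of y "rat_point p q"] by linarith
  qed
  then show ?thesis using that z'z by blast
qed

section \<open>Hausdorff measure\<close>

lemma diam_le:
  assumes "U \<noteq> {}" "\<And>x y. x \<in> U \<Longrightarrow> y \<in> U \<Longrightarrow> d x y \<le> r"
  shows "diam d U \<le> r"
  unfolding diam_def using assms by (auto intro!: cSUP_least)

lemma le_diam:
  assumes "\<And>x y. x \<in> U \<Longrightarrow> y \<in> U \<Longrightarrow> d x y \<le> r" "x \<in> U" "y \<in> U"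
  shows "d x y \<le> diam d U"
proof -
  have "bdd_above ((\<lambda>(x, y). d x y) ` (U \<times> U))"
    using assms(1) by (auto intro!: bdd_aboveI2)
  then have "(case (x, y) of (x, y) \<Rightarrow> d x y) \<le> (SUP (x, y)\<in>U \<times> U. d x y)"
    using assms(2,3) by (intro cSUP_upper) auto
  then show ?thesis using assms(2) by (auto simp: diam_def)
qed

lemma delta_covers_mono: "E \<subseteq> F \<Longrightarrow> delta_covers d \<delta> F \<subseteq> delta_covers d \<delta> E"
  by (auto simp: delta_covers_def)

lemma hausdorff_measure_mono:
  assumes "E \<subseteq> F"
  shows "hausdorff_measure d s E \<le> hausdorff_measure d s F"
  unfolding hausdorff_measure_def hausdorff_premeasure_def
  using delta_covers_mono[OF assms] by (intro SUP_mono bexI INF_superset_mono) auto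

lemma hausdorff_dim_mono:
  assumes "E \<subseteq> F"
  shows "hausdorff_dim d E \<le> hausdorff_dim d F"
  unfolding hausdorff_dim_def
proof (intro INF_superset_mono subsetI order_refl)
  fix s assume "s \<in> {s. 0 \<le> s \<and> hausdorff_measure d s F = 0}"
  then show "s \<in> {s. 0 \<le> s \<and> hausdorff_measure d s E = 0}"
    using hausdorff_measure_mono[OF assms, of d s] by auto
qed

text \<open>Pulling a cover of \<open>E\<close> back along a map with Hoelder inverse gives a cover of the unit
  interval by sets whose lengths are controlled by \<open>diam_pow\<close>.\<close>
lemma hausdorff_measure_pos:
  fixes X :: "real \<Rightarrow> 'a"
  assumes u: "0 \<le> u" and C: "0 < C"
    and X: "\<And>t. t \<in> {0..<1} \<Longrightarrow> X t \<in> E"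
    and dpos: "\<And>x y. 0 \<le> d x y"
    and holder: "\<And>t t'. \<lbrakk>t \<in> {0..<1}; t' \<in> {0..<1}; t \<noteq> t'\<rbrakk>
      \<Longrightarrow> d (X t) (X t') \<noteq> 0 \<and> \<bar>t - t'\<bar> \<le> C * d (X t) (X t') powr u"
  shows "hausdorff_measure d u E \<noteq> 0"
proof -
  have main: "ennreal (1 / (2 * C)) \<le> (\<Sum>i. ennreal (diam_pow d u (U i)))"
    if U: "U \<in> delta_covers d 1 E" for U
  proof -
    define T where "T = (\<lambda>i. {t \<in> {0..<1}. X t \<in> U i})"
    define L where "L = (\<lambda>i. C * diam_pow d u (U i))"
    \<comment> \<open>The preimages \<open>T i\<close> need not be measurable, so each is enclosed
      in an interval of half-width \<open>L i\<close> around one of its elements. This accounts for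
      the 2 in \<open>1 / (2 * C)\<close>.\<close>
    define V where "V = (\<lambda>i. if T i = {} then {} else
      {(SOME t. t \<in> T i) - L i .. (SOME t. t \<in> T i) + L i})"
    have bd: "d x y \<le> 1" if "x \<in> U i" "y \<in> U i" for x y i
      using U that by (auto simp: delta_covers_def)
    have L0: "0 \<le> L i" for i using C by (auto simp: L_def diam_pow_def)
    have TL: "\<bar>t - t'\<bar> \<le> L i" if t: "t \<in> T i" "t' \<in> T i" for t t' i
    proof (cases "t = t'")
      case True
      then show ?thesis using L0 by simp
    next
      case False
      have "d (X t) (X t') powr u \<le> diam_pow d u (U i)"
      \<comment> \<open>For exponent 0, \<open>diam_pow\<close> is 1 on nonempty sets by convention,
        which bounds any zeroth power.\<close>
      proof (cases "u = 0")
        case True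
        then show ?thesis using t by (auto simp: T_def diam_pow_def)
      next
        case u': False
        have "d (X t) (X t') \<le> diam d (U i)"
          using t by (intro le_diam[of _ _ 1] bd) (auto simp: T_def)
        then show ?thesis using t u u' dpos
          by (auto simp: T_def diam_pow_def intro!: powr_mono2)
      qed
      then have "C * d (X t) (X t') powr u \<le> L i"
        using C by (simp add: L_def)
      moreover have "\<bar>t - t'\<bar> \<le> C * d (X t) (X t') powr u"
        using holder[of t t'] t False by (auto simp: T_def)
      ultimately show ?thesis by simp
    qed
    have TV: "T i \<subseteq> V i" for i
    proof
      fix t assume t: "t \<in> T i"
      then have "(SOME t. t \<in> T i) \<in> T i" by (rule someI)
      from TL[OF t this] t show "t \<in> V i" by (auto simp: V_def abs_le_iff)
    qed
    have "{0..<1} \<subseteq> (\<Union>i. T i)"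
      using U X by (fastforce simp: T_def delta_covers_def)
    then have sub: "{0..<1} \<subseteq> (\<Union>i. V i)" using TV by blast
    have "(1::ennreal) = emeasure lborel {0..<1::real}" by simp
    also have "\<dots> \<le> emeasure lborel (\<Union>i. V i)"
      using sub by (intro emeasure_mono) (auto simp: V_def)
    also have "\<dots> \<le> (\<Sum>i. emeasure lborel (V i))"
      by (intro emeasure_subadditive_countably) (auto simp: V_def)
    also have "\<dots> \<le> (\<Sum>i. ennreal (2 * C) * ennreal (diam_pow d u (U i)))"
    proof (intro suminf_le summableI)
      fix i
      have "emeasure lborel (V i) \<le> ennreal (2 * L i)"
        using L0 by (auto simp: V_def)
      also have "\<dots> = ennreal (2 * C) * ennreal (diam_pow d u (U i))"
        using C by (simp add: L_def mult.assoc flip: ennreal_mult')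
      finally show "emeasure lborel (V i) \<le> \<dots>" .
    qed
    also have "\<dots> = ennreal (2 * C) * (\<Sum>i. ennreal (diam_pow d u (U i)))"
      by (rule ennreal_suminf_cmult)
    finally have *: "1 \<le> ennreal (2 * C) * (\<Sum>i. ennreal (diam_pow d u (U i)))" .
    have "ennreal (1 / (2 * C)) * 1 \<le> ennreal (1 / (2 * C)) * (ennreal (2 * C) * (\<Sum>i. ennreal (diam_pow d u (U i))))"
      by (intro mult_left_mono *) auto
    also have "\<dots> = ennreal (1 / (2 * C) * (2 * C)) * (\<Sum>i. ennreal (diam_pow d u (U i)))"
      using C by (subst ennreal_mult) (auto simp: mult.assoc)
    finally show ?thesis using C by simp
  qed
  have "0 < ennreal (1 / (2 * C))" using C by simp
  also have "\<dots> \<le> hausdorff_premeasure d u 1 E"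
    unfolding hausdorff_premeasure_def by (intro INF_greatest main)
  also have "\<dots> \<le> hausdorff_measure d u E"
    unfolding hausdorff_measure_def by (intro SUP_upper) auto
  finally show ?thesis by simp
qed

lemma hausdorff_dim_le:
  assumes "0 \<le> s" "hausdorff_measure d s E = 0"
  shows "hausdorff_dim d E \<le> ennreal s"
  unfolding hausdorff_dim_def using assms by (intro INF_lower) auto

text \<open>The integer part of \<open>t * M ^ i\<close> determines the earlier ones through
  division by \<open>M\<close>. Those of \<open>t\<close> and \<open>t'\<close> agree for
  \<open>i = 0\<close> and disagree eventually. If \<open>Suc j\<close> is the first disagreement,
  digit \<open>j\<close> differs, while agreement at \<open>j\<close> puts both numbers into one
  \<open>M\<close>-adic interval of length \<open>1 / M ^ j\<close>.\<close>

lemma first_differing_digit: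
  fixes t t' :: real
  assumes M: "2 \<le> M" and t: "t \<in> {0..<1}" "t' \<in> {0..<1}" "t \<noteq> t'"
  defines "D \<equiv> \<lambda>t i. nat \<lfloor>t * real M ^ Suc i\<rfloor> mod M"
  obtains j where "\<And>i. i < j \<Longrightarrow> D t i = D t' i" "D t j \<noteq> D t' j" "\<bar>t - t'\<bar> \<le> 1 / real M ^ j"
proof -
  define F where "F = (\<lambda>t i. nat \<lfloor>t * real M ^ i\<rfloor>)"
  have F0: "F t 0 = F t' 0"
    using t by (auto simp: F_def)
  have Fdiv: "F s i = F s (Suc i) div M" if "0 \<le> s" for s i
  proof -
    have "real M > 0" using M by simp
    then have "s * real M ^ i = (s * real M ^ Suc i) / real M" by simp
    then have "\<lfloor>s * real M ^ i\<rfloor> = \<lfloor>s * real M ^ Suc i\<rfloor> div int M"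
      using floor_divide_real_eq_div[of "int M" "s * real M ^ Suc i"] by simp
    then show ?thesis using that by (simp add: F_def nat_div_distrib)
  qed
  have close: "\<bar>t - t'\<bar> \<le> 1 / real M ^ i" if "F t i = F t' i" for i
  proof -
    have "\<lfloor>t * real M ^ i\<rfloor> = \<lfloor>t' * real M ^ i\<rfloor>"
      using that t by (simp add: F_def eq_nat_nat_iff)
    then have "\<bar>t * real M ^ i - t' * real M ^ i\<bar> \<le> 1" by linarith
    then have "\<bar>t - t'\<bar> * real M ^ i \<le> 1"
      by (metis abs_mult abs_of_nonneg left_diff_distrib of_nat_0_le_iff zero_le_power)
    then show ?thesis using M by (simp add: field_simps)
  qed
  have ex: "\<exists>i. F t i \<noteq> F t' i"
  proof (rule ccontr)
    assume "\<not> ?thesis"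
    then have le: "\<bar>t - t'\<bar> \<le> 1 / real M ^ i" for i using close by blast
    have "(\<lambda>i. (1 / real M) ^ i) \<longlonglongrightarrow> 0"
      using M by (intro LIMSEQ_realpow_zero) auto
    then have "\<bar>t - t'\<bar> \<le> 0"
      using le by (intro LIMSEQ_le_const) (auto simp: power_divide)
    then show False using t by simp
  qed
  define k where "k = (LEAST i. F t i \<noteq> F t' i)"
  have k: "F t k \<noteq> F t' k" unfolding k_def by (rule LeastI_ex[OF ex])
  have less: "F t i = F t' i" if "i < k" for i
    using not_less_Least[of i "\<lambda>i. F t i \<noteq> F t' i"] that by (auto simp: k_def)
  obtain j where j: "k = Suc j" using k F0 by (cases k) auto
  show ?thesis
  proof
    show "D t i = D t' i" if "i < j" for i
      using less[of "Suc i"] that j by (simp add: D_def F_def)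
    show "D t j \<noteq> D t' j"
    proof
      assume "D t j = D t' j"
      then have "F t (Suc j) mod M = F t' (Suc j) mod M" by (simp add: D_def F_def)
      moreover have "F t (Suc j) div M = F t' (Suc j) div M"
        using Fdiv[of t j] Fdiv[of t' j] less[of j] j t by simp
      ultimately have "F t (Suc j) = F t' (Suc j)" by (metis div_mult_mod_eq)
      then show False using k j by simp
    qed
    show "\<bar>t - t'\<bar> \<le> 1 / real M ^ j" using close less[of j] j by simp
  qed
qed

section \<open>Cantor sets of nested balls\<close>

text \<open>\<open>J\<close> is the set of levels at which the ball is centred at a rational point; at level \<open>Suc j\<close>
  its denominator is at most \<open>A j ^ n\<close>.\<close>
locale nested_balls =
  fixes z0 :: "real ^ 'n" and \<rho> :: "nat \<Rightarrow> real" and J :: "nat set" and A :: "nat \<Rightarrow> nat" and N :: nat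
  assumes N: "1 \<le> N"
    and radius_0: "\<rho> 0 = 1"
    and radius_pos: "0 < \<rho> j"
    and radius_step: "Suc j \<notin> J \<Longrightarrow> \<rho> (Suc j) = \<rho> j / (16 * N)"
    and radius_jump: "Suc j \<in> J \<Longrightarrow> \<rho> (Suc j) \<le> \<rho> j / (32 * N)"
    and A_pos: "Suc j \<in> J \<Longrightarrow> 1 \<le> A j"
    and A_ge: "Suc j \<in> J \<Longrightarrow> 64 * real N * (2 * real CARD('n) + 1) \<le> real (A j) * root (Suc CARD('n)) (\<rho> j)"
    and A_ge': "Suc j \<in> J \<Longrightarrow> i \<le> j \<Longrightarrow> i \<in> insert 0 J \<Longrightarrow> 4 \<le> real (A j) * \<rho> i"
begin

section \<open>Decay of the radii and the resulting thresholds for denominators\<close>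

lemma radius_Suc_le: "\<rho> (Suc j) \<le> \<rho> j / (16 * N)"
proof (cases "Suc j \<in> J")
  case True
  have "\<rho> (Suc j) \<le> \<rho> j / (32 * N)" using radius_jump True .
  also have "\<dots> \<le> \<rho> j / (16 * N)"
    using N radius_pos[of j] by (intro divide_left_mono) auto
  finally show ?thesis .
qed (simp add: radius_step)

lemma radius_antimono: "i \<le> j \<Longrightarrow> \<rho> j \<le> \<rho> i"
proof (induction rule: dec_induct)
  case (step j)
  have "\<rho> (Suc j) \<le> \<rho> j / (16 * N)" by (rule radius_Suc_le)
  also have "\<dots> \<le> \<rho> j / 1" using N radius_pos[of j] by (intro divide_left_mono) auto
  finally show ?case using step by simp
qed simp

lemma radius_le_1: "\<rho> j \<le> 1"
  using radius_antimono[of 0 j] radius_0 by simp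

lemma radius_tendsto_0: "\<rho> \<longlonglongrightarrow> 0"
proof -
  have le: "\<rho> j \<le> (1 / 2) ^ j" for j
  proof (induction j)
    case (Suc j)
    have "\<rho> (Suc j) \<le> \<rho> j / (16 * N)" by (rule radius_Suc_le)
    also have "\<dots> \<le> \<rho> j / 2" using N radius_pos[of j] by (intro divide_left_mono) auto
    finally show ?case using Suc by simp
  qed (simp add: radius_0)
  show ?thesis
  proof (rule tendsto_sandwich[of "\<lambda>_. 0" _ _ "\<lambda>j. (1 / 2) ^ j"])
    show "(\<lambda>j. (1 / 2 :: real) ^ j) \<longlonglongrightarrow> 0" by (intro LIMSEQ_realpow_zero) auto
  qed (auto simp: le radius_pos less_imp_le)
qed

lemma radius_eq_root_pow: "\<rho> j = root (Suc CARD('n)) (\<rho> j) ^ Suc CARD('n)"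
  using radius_pos[of j] by (simp del: power_Suc)

text \<open>Ensures that the first level at which a denominator becomes low has a
  predecessor.\<close>

lemma not_low_denominator_0: "1 \<le> q \<Longrightarrow> \<not> low_denominator CARD('n) (\<rho> 0) q"
proof
  assume "1 \<le> q" "low_denominator CARD('n) (\<rho> 0) q"
  then have "(2 * real CARD('n) + 1) * real q < 1 * 1"
    by (simp add: low_denominator_def radius_0)
  moreover have "1 * 1 \<le> (2 * real CARD('n) + 1) * real q"
    using \<open>1 \<le> q\<close> by (intro mult_mono) auto
  ultimately show False by linarith
qed

lemma ex_low_denominator: "\<exists>j. low_denominator CARD('n) (\<rho> j) q"
proof -
  have "(\<lambda>j. (2 * real CARD('n) + 1) * real q * root (Suc CARD('n)) (\<rho> j) ^ CARD('n))
      \<longlonglongrightarrow> (2 * real CARD('n) + 1) * real q * root (Suc CARD('n)) 0 ^ CARD('n)"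
    by (intro tendsto_intros radius_tendsto_0)
  then have "eventually (\<lambda>j. (2 * real CARD('n) + 1) * real q * root (Suc CARD('n)) (\<rho> j) ^ CARD('n) < 1) sequentially"
    by (intro order_tendstoD(2)[where y = 0]) (auto simp: zero_power)
  then show ?thesis
    unfolding low_denominator_def by (auto dest: eventually_happens)
qed

text \<open>Write \<open>\<rho> k\<close> as \<open>h ^ (n + 1)\<close>: one factor \<open>h\<close>
  is paired with \<open>A j\<close> by \<open>A_ge\<close>, the remaining \<open>h ^ n\<close> with
  \<open>q\<close> because \<open>q\<close> is not low. The error term of Dirichlet's theorem thus
  becomes a fraction of the radius.\<close>

lemma inverse_high_denominator_le:
  assumes "Suc j \<in> J" "k \<le> j" "1 \<le> q" "\<not> low_denominator CARD('n) (\<rho> k) q"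
  shows "1 / (real q * real (A j)) \<le> \<rho> k / (64 * N)"
proof -
  define h where "h = root (Suc CARD('n)) (\<rho> k)"
  have h: "0 < h" using radius_pos by (simp add: h_def)
  have "root (Suc CARD('n)) (\<rho> j) \<le> h"
    unfolding h_def using radius_antimono[OF assms(2)] by simp
  then have "real (A j) * root (Suc CARD('n)) (\<rho> j) \<le> real (A j) * h"
    by (intro mult_left_mono) auto
  then have 1: "64 * real N * (2 * real CARD('n) + 1) \<le> real (A j) * h"
    using A_ge[OF assms(1)] by linarith
  have 2: "1 \<le> (2 * real CARD('n) + 1) * real q * h ^ CARD('n)"
    using assms(4) by (simp add: low_denominator_def h_def)
  have "64 * real N * 1 \<le> 64 * real N * ((2 * real CARD('n) + 1) * real q * h ^ CARD('n))"
    using 2 by (intro mult_left_mono) auto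
  also have "\<dots> = (64 * real N * (2 * real CARD('n) + 1)) * (real q * h ^ CARD('n))" by simp
  also have "\<dots> \<le> (real (A j) * h) * (real q * h ^ CARD('n))"
    using h by (intro mult_right_mono 1) auto
  also have "\<dots> = \<rho> k * (real q * real (A j))"
    by (subst radius_eq_root_pow) (simp add: h_def)
  finally show ?thesis
    using N assms(3) A_pos[OF assms(1)] by (simp add: field_simps)
qed

text \<open>A rational point with denominator at most \<open>A\<^sup>n\<close> provided by Dirichlet's theorem cannot have a
  small denominator, because \<open>w\<close> stays away from such points; hence it is very close to \<open>w\<close>.\<close>
lemma ex_jump_target:
  assumes J: "Suc j \<in> J"
    and far: "\<And>i p q. \<lbrakk>i \<le> j; 1 \<le> q; low_denominator CARD('n) (\<rho> i) q\<rbrakk>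
      \<Longrightarrow> \<rho> i / 4 \<le> max_dist w (rat_point p q)"
  obtains p :: "int ^ 'n" and q where "1 \<le> q" "q \<le> A j ^ CARD('n)"
    "max_dist w (rat_point p q) \<le> \<rho> j / (64 * N)"
proof -
  obtain p q where q: "1 \<le> q" "q \<le> A j ^ CARD('n)"
    and close: "max_dist w (rat_point p q) < 1 / (real q * real (A j))"
    using dirichlet_simultaneous[OF A_pos[OF J], of w] by metis
  have high: "\<not> low_denominator CARD('n) (\<rho> j) q"
  proof
    assume low: "low_denominator CARD('n) (\<rho> j) q"
    define i where "i = (LEAST i. low_denominator CARD('n) (\<rho> i) q)"
    have i: "low_denominator CARD('n) (\<rho> i) q" unfolding i_def using low by (rule LeastI)
    have ij: "i \<le> j" unfolding i_def using low by (rule Least_le)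
    have *: "\<rho> i / 4 < 1 / (real q * real (A j))" using far[OF ij q(1) i, of p] close by linarith
    show False
    \<comment> \<open>At level 0 or a jump level, \<open>A_ge'\<close> gives
      \<open>1 / A j \<le> \<rho> i / 4\<close>. At an ordinary level \<open>i = Suc k\<close>, the
      denominator is still high at level \<open>k\<close>, and the bound
      \<open>\<rho> k / (64 * N)\<close> is exactly \<open>\<rho> i / 4\<close>.\<close>
    proof (cases "i \<in> insert 0 J")
      case True
      have "1 / (real q * real (A j)) \<le> 1 / (1 * real (A j))"
        using q A_pos[OF J] by (intro divide_left_mono mult_right_mono) auto
      with * have "\<rho> i / 4 < 1 / real (A j)" by simp
      then have "real (A j) * \<rho> i < 4" using A_pos[OF J] by (simp add: field_simps)
      then show False using A_ge'[OF J ij True] by simp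
    next
      case False
      then obtain k where k: "i = Suc k" "Suc k \<notin> J" by (cases i) auto
      have "\<not> low_denominator CARD('n) (\<rho> k) q"
        using not_less_Least[of k "\<lambda>i. low_denominator CARD('n) (\<rho> i) q"] k by (simp add: i_def)
      then have "1 / (real q * real (A j)) \<le> \<rho> k / (64 * N)"
        using inverse_high_denominator_le[OF J _ q(1), of k] k ij by simp
      with * show False using radius_step[OF k(2)] k(1) by simp
    qed
  qed
  show ?thesis
    using that[OF q, of p] close inverse_high_denominator_le[OF J order_refl q(1) high] by linarith
qed

section \<open>The nested balls and their limit points\<close>

definition safe_center :: "nat \<Rightarrow> real ^ 'n \<Rightarrow> real ^ 'n" where
  "safe_center j z = (SOME z'. max_dist z' z \<le> \<rho> j / 2 \<and>
     (\<forall>y p q. max_dist y z' \<le> \<rho> j / 4 \<longrightarrow> 1 \<le> q \<longrightarrow> low_denominator CARD('n) (\<rho> j) q \<longrightarrow>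
        \<rho> j / 4 \<le> max_dist y (rat_point p q)))"

text \<open>For indices below \<open>N\<close> this is a grid based at the safe center. Its spacing
  keeps the balls of radius \<open>\<rho> j / (16 * N)\<close> around the grid points apart and
  inside the safe ball of radius \<open>\<rho> j / 4\<close>.\<close>

definition child :: "nat \<Rightarrow> real ^ 'n \<Rightarrow> ('n \<Rightarrow> nat) \<Rightarrow> real ^ 'n" where
  "child j z k = safe_center j z + (\<chi> i. \<rho> j / (4 * N) * real (k i))"

text \<open>At ordinary levels \<open>\<rho> (Suc j)\<close> equals the right-hand side, so the
  inequality forces the center to be the child itself; at jump levels the slack leaves room to move
  to a nearby rational point.\<close>

primrec center :: "(nat \<Rightarrow> 'n \<Rightarrow> nat) \<Rightarrow> nat \<Rightarrow> real ^ 'n" where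
  "center \<sigma> 0 = z0"
| "center \<sigma> (Suc j) = (SOME z. max_dist z (child j (center \<sigma> j) (\<sigma> j)) + \<rho> (Suc j) \<le> \<rho> j / (16 * N) \<and>
     (Suc j \<in> J \<longrightarrow> (\<exists>p q. 1 \<le> q \<and> q \<le> A j ^ CARD('n) \<and> z = rat_point p q)))"

definition point :: "(nat \<Rightarrow> 'n \<Rightarrow> nat) \<Rightarrow> real ^ 'n" where
  "point \<sigma> = (SOME x. \<forall>j. max_dist x (center \<sigma> j) \<le> \<rho> j)"

lemma safe_center:
  shows safe_center_near: "max_dist (safe_center j z) z \<le> \<rho> j / 2"
    and safe_center_far: "\<lbrakk>max_dist y (safe_center j z) \<le> \<rho> j / 4; 1 \<le> q; low_denominator CARD('n) (\<rho> j) q\<rbrakk>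
      \<Longrightarrow> \<rho> j / 4 \<le> max_dist y (rat_point p q)"
proof -
  have "\<exists>z'. max_dist z' z \<le> \<rho> j / 2 \<and>
     (\<forall>y p q. max_dist y z' \<le> \<rho> j / 4 \<longrightarrow> 1 \<le> q \<longrightarrow> low_denominator CARD('n) (\<rho> j) q \<longrightarrow>
        \<rho> j / 4 \<le> max_dist y (rat_point p q))"
    using ex_ball_away_from_rationals[of "\<rho> j" z, OF radius_pos radius_le_1] by metis
  from someI_ex[OF this]
  show "max_dist (safe_center j z) z \<le> \<rho> j / 2"
    "\<lbrakk>max_dist y (safe_center j z) \<le> \<rho> j / 4; 1 \<le> q; low_denominator CARD('n) (\<rho> j) q\<rbrakk>
      \<Longrightarrow> \<rho> j / 4 \<le> max_dist y (rat_point p q)"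
    unfolding safe_center_def[symmetric] by blast+
qed

lemma ball_child_subset_safe:
  assumes k: "\<And>i. k i < N" and y: "max_dist y (child j z k) \<le> \<rho> j / (16 * N)"
  shows "max_dist y (safe_center j z) \<le> \<rho> j / 4"
proof -
  have "max_dist (child j z k) (safe_center j z) \<le> \<rho> j / (4 * N) * (real N - 1)"
    unfolding max_dist_le_iff
  proof
    fix i
    have "real (k i) \<le> real N - 1" using k[of i] by linarith
    then have "\<rho> j / (4 * N) * real (k i) \<le> \<rho> j / (4 * N) * (real N - 1)"
      using radius_pos[of j] by (intro mult_left_mono) auto
    then show "\<bar>child j z k $ i - safe_center j z $ i\<bar> \<le> \<rho> j / (4 * N) * (real N - 1)"
      using radius_pos[of j] by (simp add: child_def)
  qed
  moreover have "\<rho> j / (16 * N) \<le> \<rho> j / (4 * N)"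
    using N radius_pos[of j] by (intro divide_left_mono) auto
  \<comment> \<open>The \<open>N - 1\<close> grid steps leave one grid cell as margin for the ball
    around the outermost child.\<close>
  moreover have "\<rho> j / (4 * N) * (real N - 1) + \<rho> j / (4 * N) = \<rho> j / 4"
    using N by (simp add: field_simps)
  ultimately show ?thesis
    using y max_dist_triangle[of y "safe_center j z" "child j z k"] by linarith
qed

lemma ball_child_subset:
  assumes k: "\<And>i. k i < N" and y: "max_dist y (child j z k) \<le> \<rho> j / (16 * N)"
  shows "max_dist y z \<le> \<rho> j"
  using ball_child_subset_safe[of k y j z, OF k y] safe_center_near[of j z]
    max_dist_triangle[of y z "safe_center j z"] radius_pos[of j] by linarith

text \<open>One induction serves all three claims: a jump target exists only if the child avoids the
  low denominators of all levels up to \<open>j\<close>, and this avoidance is inherited only if the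
  next ball lies in the child ball.\<close>

lemma
  assumes \<sigma>: "\<And>j i. \<sigma> j i < N"
  shows center_Suc_near: "max_dist (center \<sigma> (Suc j)) (child j (center \<sigma> j) (\<sigma> j)) + \<rho> (Suc j) \<le> \<rho> j / (16 * N)"
    and center_jump: "Suc j \<in> J \<Longrightarrow> \<exists>p q. 1 \<le> q \<and> q \<le> A j ^ CARD('n) \<and> center \<sigma> (Suc j) = rat_point p q"
    and center_far: "\<lbrakk>max_dist y (center \<sigma> j) \<le> \<rho> j; i < j; 1 \<le> q; low_denominator CARD('n) (\<rho> i) q\<rbrakk>
      \<Longrightarrow> \<rho> i / 4 \<le> max_dist y (rat_point p q)"
proof -
  \<comment> \<open>\<open>R\<close> is the property demanded by the choice in
    \<open>center\<close>; \<open>far\<close> is the avoidance accumulated over the levels below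
    \<open>j\<close>.\<close>
  define R where "R = (\<lambda>j (z :: real ^ 'n). max_dist z (child j (center \<sigma> j) (\<sigma> j)) + \<rho> (Suc j) \<le> \<rho> j / (16 * N) \<and>
     (Suc j \<in> J \<longrightarrow> (\<exists>p q. 1 \<le> q \<and> q \<le> A j ^ CARD('n) \<and> z = rat_point p q)))"
  define far where "far = (\<lambda>j (y :: real ^ 'n). \<forall>i p q. i < j \<longrightarrow> 1 \<le> q \<longrightarrow> low_denominator CARD('n) (\<rho> i) q \<longrightarrow>
    \<rho> i / 4 \<le> max_dist y (rat_point p q))"
  have step: "R j (center \<sigma> (Suc j)) \<and> (\<forall>y. max_dist y (center \<sigma> (Suc j)) \<le> \<rho> (Suc j) \<longrightarrow> far (Suc j) y)"
    if IH: "\<forall>y. max_dist y (center \<sigma> j) \<le> \<rho> j \<longrightarrow> far j y" for j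
  proof -
    define w where "w = child j (center \<sigma> j) (\<sigma> j)"
    have far_child: "far (Suc j) y" if y: "max_dist y w \<le> \<rho> j / (16 * N)" for y
    proof -
      have "far j y"
        using IH ball_child_subset[of "\<sigma> j" y j "center \<sigma> j"] \<sigma> y by (simp add: w_def)
      moreover have "\<rho> j / 4 \<le> max_dist y (rat_point p q)"
        if "1 \<le> q" "low_denominator CARD('n) (\<rho> j) q" for p q
        using safe_center_far ball_child_subset_safe[of "\<sigma> j" y j "center \<sigma> j"] \<sigma> y that
        by (simp add: w_def)
      ultimately show ?thesis by (auto simp: far_def less_Suc_eq)
    qed
    have "\<exists>z. R j z"
    proof (cases "Suc j \<in> J")
      case True
      have "far (Suc j) w" using far_child[of w] radius_pos[of j] by simp
      then obtain p :: "int ^ 'n" and q where pq: "1 \<le> q" "q \<le> A j ^ CARD('n)"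
        "max_dist w (rat_point p q) \<le> \<rho> j / (64 * N)"
        using ex_jump_target[OF True, of w] unfolding far_def by (metis less_Suc_eq_le)
      have "max_dist (rat_point p q) w + \<rho> (Suc j) \<le> \<rho> j / (64 * N) + \<rho> j / (32 * N)"
        using pq(3) radius_jump[OF True] by (simp add: max_dist_commute)
      also have "\<dots> \<le> \<rho> j / (16 * N)"
        using N radius_pos[of j] by (simp add: field_simps)
      finally have "R j (rat_point p q)" using pq unfolding R_def w_def by blast
      then show ?thesis by blast
    next
      case False
      then have "R j w" by (simp add: R_def w_def radius_step)
      then show ?thesis by blast
    qed
    then have R: "R j (center \<sigma> (Suc j))"
      unfolding center.simps R_def by (rule someI_ex)
    moreover have "far (Suc j) y" if "max_dist y (center \<sigma> (Suc j)) \<le> \<rho> (Suc j)" for y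
    proof (rule far_child)
      show "max_dist y w \<le> \<rho> j / (16 * N)"
        using R that max_dist_triangle[of y w "center \<sigma> (Suc j)"]
        by (simp add: R_def w_def del: center.simps)
    qed
    ultimately show ?thesis by blast
  qed
  have all: "\<forall>y. max_dist y (center \<sigma> j) \<le> \<rho> j \<longrightarrow> far j y" for j
  proof (induction j)
    case 0
    show ?case by (simp add: far_def)
  next
    case (Suc j)
    then show ?case using step by blast
  qed
  have R: "R j (center \<sigma> (Suc j))" for j using step all by blast
  show "max_dist (center \<sigma> (Suc j)) (child j (center \<sigma> j) (\<sigma> j)) + \<rho> (Suc j) \<le> \<rho> j / (16 * N)"
    and "Suc j \<in> J \<Longrightarrow> \<exists>p q. 1 \<le> q \<and> q \<le> A j ^ CARD('n) \<and> center \<sigma> (Suc j) = rat_point p q"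
    using R[of j] unfolding R_def by blast+
  show "\<lbrakk>max_dist y (center \<sigma> j) \<le> \<rho> j; i < j; 1 \<le> q; low_denominator CARD('n) (\<rho> i) q\<rbrakk>
      \<Longrightarrow> \<rho> i / 4 \<le> max_dist y (rat_point p q)"
    using all unfolding far_def by blast
qed

lemma ball_center_subset_child:
  assumes \<sigma>: "\<And>j i. \<sigma> j i < N" and y: "max_dist y (center \<sigma> (Suc j)) \<le> \<rho> (Suc j)"
  shows "max_dist y (child j (center \<sigma> j) (\<sigma> j)) \<le> \<rho> j / (16 * N)"
  using center_Suc_near[of \<sigma> j, OF \<sigma>] y
    max_dist_triangle[of y "child j (center \<sigma> j) (\<sigma> j)" "center \<sigma> (Suc j)"] by linarith

text \<open>Nested nonempty compact balls have a common point, which justifies the choice in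
  \<open>point\<close>.\<close>

lemma point_near_center:
  assumes \<sigma>: "\<And>j i. \<sigma> j i < N"
  shows "max_dist (point \<sigma>) (center \<sigma> j) \<le> \<rho> j"
proof -
  define K where "K = (\<lambda>j. {y. max_dist y (center \<sigma> j) \<le> \<rho> j})"
  have Suc: "K (Suc j) \<subseteq> K j" for j
    unfolding K_def using ball_child_subset[of "\<sigma> j"] ball_center_subset_child[of \<sigma> _ j, OF \<sigma>] \<sigma> by blast
  have "\<Inter>(range K) \<noteq> {}"
  proof (rule compact_nest)
    show "compact (K j)" for j unfolding K_def by (rule compact_max_dist_ball)
    show "K j \<noteq> {}" for j
    proof -
      have "center \<sigma> j \<in> K j" using radius_pos[of j] by (simp add: K_def)
      then show ?thesis by blast
    qed
    show "K j \<subseteq> K i" if "i \<le> j" for i j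
      using lift_Suc_antimono_le[of K, OF Suc that] .
  qed
  then have "\<exists>x. \<forall>j. max_dist x (center \<sigma> j) \<le> \<rho> j" by (auto simp: K_def)
  from someI_ex[OF this] show ?thesis by (simp add: point_def)
qed

lemma point_far:
  assumes "\<And>j i. \<sigma> j i < N" "1 \<le> q" "low_denominator CARD('n) (\<rho> j) q"
  shows "\<rho> j / 4 \<le> max_dist (point \<sigma>) (rat_point p q)"
  using center_far[of \<sigma> "point \<sigma>" "Suc j" j] point_near_center[of \<sigma> "Suc j"] assms by blast

lemma point_near_jump_target:
  assumes "\<And>j i. \<sigma> j i < N" "Suc j \<in> J"
  obtains p q where "1 \<le> q" "q \<le> A j ^ CARD('n)" "max_dist (point \<sigma>) (rat_point p q) \<le> \<rho> (Suc j)"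
  using center_jump[of \<sigma> j] point_near_center[of \<sigma> "Suc j"] assms by metis

lemma center_cong: "(\<And>i. i < j \<Longrightarrow> \<sigma> i = \<sigma>' i) \<Longrightarrow> center \<sigma> j = center \<sigma>' j"
  by (induction j) simp_all

text \<open>Equal prefixes lead to the same ball, so the points lie near distinct children of it.
  The grid spacing \<open>\<rho> j / (4 * N)\<close> minus twice the radius
  \<open>\<rho> j / (16 * N)\<close> leaves \<open>\<rho> j / (8 * N)\<close>.\<close>

lemma point_separated:
  assumes \<sigma>: "\<And>j i. \<sigma> j i < N" and \<sigma>': "\<And>j i. \<sigma>' j i < N"
    and same: "\<And>i. i < j \<Longrightarrow> \<sigma> i = \<sigma>' i" and diff: "\<sigma> j \<noteq> \<sigma>' j"
  shows "\<rho> j / (8 * N) \<le> max_dist (point \<sigma>) (point \<sigma>')"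
proof -
  define z where "z = center \<sigma> j"
  have z: "center \<sigma>' j = z" unfolding z_def using center_cong[of j \<sigma> \<sigma>'] same by simp
  have near: "max_dist (point \<sigma>) (child j z (\<sigma> j)) \<le> \<rho> j / (16 * N)"
    "max_dist (point \<sigma>') (child j z (\<sigma>' j)) \<le> \<rho> j / (16 * N)"
    using ball_center_subset_child[of \<sigma> "point \<sigma>" j] ball_center_subset_child[of \<sigma>' "point \<sigma>'" j]
      point_near_center[of \<sigma> "Suc j"] point_near_center[of \<sigma>' "Suc j"] \<sigma> \<sigma>' z
    unfolding z_def by metis+
  obtain i where i: "\<sigma> j i \<noteq> \<sigma>' j i" using diff by blast
  have "1 \<le> \<bar>real (\<sigma> j i) - real (\<sigma>' j i)\<bar>" using i by linarith
  then have "\<rho> j / (4 * N) * 1 \<le> \<rho> j / (4 * N) * \<bar>real (\<sigma> j i) - real (\<sigma>' j i)\<bar>"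
    using radius_pos[of j] by (intro mult_left_mono) auto
  also have "\<dots> = \<bar>child j z (\<sigma> j) $ i - child j z (\<sigma>' j) $ i\<bar>"
    using radius_pos[of j]
    by (simp add: child_def abs_mult flip: right_diff_distrib times_divide_eq_left)
  also have "\<dots> \<le> max_dist (child j z (\<sigma> j)) (child j z (\<sigma>' j))"
    by (rule component_le_max_dist)
  also have "\<dots> \<le> max_dist (point \<sigma>) (child j z (\<sigma> j)) + max_dist (point \<sigma>) (point \<sigma>')
      + max_dist (point \<sigma>') (child j z (\<sigma>' j))"
    using max_dist_triangle[of "child j z (\<sigma> j)" "child j z (\<sigma>' j)" "point \<sigma>"]
      max_dist_triangle[of "point \<sigma>" "child j z (\<sigma>' j)" "point \<sigma>'"]
      max_dist_commute[of "point \<sigma>" "child j z (\<sigma> j)"] by linarith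
  also have "\<dots> \<le> \<rho> j / (16 * N) + max_dist (point \<sigma>) (point \<sigma>') + \<rho> j / (16 * N)"
    using near by (intro add_mono) auto
  finally show ?thesis using N by (simp add: field_simps)
qed

end

section \<open>The sequence of radii\<close>

lemma ex_nat_root:
  assumes "1 \<le> n" "1 \<le> Q"
  obtains A :: nat where "1 \<le> A" "A ^ n \<le> Q" "Q < (A + 1) ^ n"
proof -
  have le: "a \<le> Q" if "a ^ n \<le> Q" for a
    using that assms self_le_power[of a n] by (cases "a = 0") auto
  define A where "A = Max {a. a ^ n \<le> Q}"
  have fin: "finite {a. a ^ n \<le> Q}" by (rule finite_subset[of _ "{..Q}"]) (use le in auto)
  have "A \<in> {a. a ^ n \<le> Q}" unfolding A_def using fin assms by (intro Max_in) (auto intro: exI[of _ 1])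
  moreover have "1 \<le> A" unfolding A_def using fin assms by (intro Max_ge) auto
  moreover have "\<not> (A + 1) ^ n \<le> Q"
  proof
    assume "(A + 1) ^ n \<le> Q"
    then have "A + 1 \<le> A" unfolding A_def using fin by (intro Max_ge) auto
    then show False by simp
  qed
  ultimately show ?thesis using that by auto
qed

lemma powr_mult_le_eventually:
  fixes a b c e :: real
  assumes "b < a" "0 < e"
  shows "eventually (\<lambda>A. c * real A powr (- a) \<le> e * real A powr (- b)) sequentially"
proof -
  have "(\<lambda>A. c * real A powr (b - a)) \<longlonglongrightarrow> c * 0"
    using assms by (intro tendsto_intros tendsto_neg_powr filterlim_real_sequentially) auto
  then have "eventually (\<lambda>A. c * real A powr (b - a) < e) sequentially"
    using assms by (intro order_tendstoD(2)[where y = 0]) auto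
  then show ?thesis
  proof eventually_elim
    case (elim A)
    have "c * real A powr (- a) = c * real A powr (b - a) * real A powr (- b)"
      by (simp flip: powr_add)
    also have "\<dots> \<le> e * real A powr (- b)" using elim by (intro mult_right_mono) auto
    finally show ?case .
  qed
qed

text \<open>\<open>small\<close> is the little-o hypothesis reduced to an eventual bound and raised
  to the \<open>n\<close>-th power, which avoids fractional exponents. \<open>unbounded\<close> is
  the negation of the bound under which the natural cover works at all exponents above
  \<open>s\<close>.\<close>

locale approximation_function =
  fixes \<psi> :: "nat \<Rightarrow> real" and n :: nat and s :: real
  assumes n: "1 \<le> n"
    and pos: "1 \<le> q \<Longrightarrow> 0 < \<psi> q"
    and antimono: "1 \<le> q \<Longrightarrow> q \<le> r \<Longrightarrow> \<psi> r \<le> \<psi> q"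
    and small: "eventually (\<lambda>q. \<psi> q ^ n * real q ^ Suc n \<le> 1) sequentially"
    and s: "0 < s"
    and unbounded: "\<And>C. \<exists>q\<ge>1. C < real q ^ Suc n * \<psi> q powr s"
begin

text \<open>The first index with value above \<open>C\<close> is a record, since all earlier values
  are at most \<open>C\<close>. Taking \<open>C\<close> to be 1 plus the sum of the values below
  \<open>q0\<close> makes the index at least \<open>q0\<close> and the value at least 1.\<close>

lemma ex_record:
  obtains Q where "1 \<le> Q" "q0 \<le> Q" "1 \<le> real Q ^ Suc n * \<psi> Q powr s"
    "\<And>q. 1 \<le> q \<Longrightarrow> q \<le> Q \<Longrightarrow> real q ^ Suc n * \<psi> q powr s \<le> real Q ^ Suc n * \<psi> Q powr s"
proof -
  define f where "f = (\<lambda>q. real q ^ Suc n * \<psi> q powr s)"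
  have f0: "0 \<le> f q" for q by (simp add: f_def)
  define C where "C = 1 + (\<Sum>q<q0. f q)"
  have C: "1 \<le> C" unfolding C_def using f0 by (simp add: sum_nonneg)
  define Q where "Q = (LEAST q. 1 \<le> q \<and> C < f q)"
  have Q: "1 \<le> Q" "C < f Q"
    using LeastI_ex[of "\<lambda>q. 1 \<le> q \<and> C < f q"] unbounded[of C] by (auto simp: Q_def f_def)
  have "q0 \<le> Q"
  proof (rule ccontr)
    assume "\<not> q0 \<le> Q"
    then have "f Q \<le> (\<Sum>q<q0. f q)" using f0 by (intro member_le_sum) auto
    then show False using Q by (simp add: C_def)
  qed
  moreover have "f q \<le> f Q" if "1 \<le> q" "q \<le> Q" for q
  proof (cases "q = Q")
    case False
    then have "q < (LEAST q. 1 \<le> q \<and> C < f q)" using that by (simp add: Q_def)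
    then have "\<not> (1 \<le> q \<and> C < f q)" by (rule not_less_Least)
    then show ?thesis using that Q by linarith
  qed simp
  ultimately show ?thesis using that[of Q] Q C by (simp add: f_def)
qed

text \<open>If \<open>s \<ge> n\<close>, then \<open>\<psi> q powr s \<le> \<psi> q ^ n\<close> once
  \<open>\<psi> q \<le> 1\<close>, and \<open>small\<close> would contradict
  \<open>unbounded\<close>.\<close>

lemma s_less_n: "s < real n"
proof (rule ccontr)
  assume ns: "\<not> s < real n"
  obtain q0 where q0: "\<And>q. q0 \<le> q \<Longrightarrow> \<psi> q ^ n * real q ^ Suc n \<le> 1"
    using small by (auto simp: eventually_sequentially)
  define f where "f = (\<lambda>q. real q ^ Suc n * \<psi> q powr s)"
  have f0: "0 \<le> f q" for q by (simp add: f_def)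
  define C where "C = 1 + (\<Sum>q<q0. f q)"
  obtain q where q: "1 \<le> q" "C < f q" using unbounded[of C] by (auto simp: f_def)
  show False
  proof (cases "q < q0")
    case True
    then have "f q \<le> (\<Sum>q<q0. f q)" using f0 by (intro member_le_sum) auto
    then show False using q by (simp add: C_def)
  next
    case False
    then have sm: "\<psi> q ^ n * real q ^ Suc n \<le> 1" using q0 by simp
    have "\<psi> q ^ n * 1 \<le> \<psi> q ^ n * real q ^ Suc n"
      using q pos[of q] by (intro mult_left_mono one_le_power) auto
    then have "\<psi> q ^ n \<le> 1 ^ n" using sm by simp
    then have "\<psi> q \<le> 1" using n by (subst (asm) power_mono_iff) (use pos[OF q(1)] in auto)
    then have "\<psi> q powr s \<le> \<psi> q powr real n"
      using ns pos[OF q(1)] by (intro powr_mono') auto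
    also have "\<dots> = \<psi> q ^ n" using pos[OF q(1)] by (simp add: powr_realpow)
    finally have "f q \<le> real q ^ Suc n * \<psi> q ^ n" unfolding f_def by (intro mult_left_mono) auto
    then have "f q \<le> 1" using sm by (simp add: mult.commute)
    moreover have "1 \<le> C" unfolding C_def using f0 by (simp add: sum_nonneg)
    ultimately show False using q by simp
  qed
qed

text \<open>The next jump is taken at the denominator bound \<open>Q\<close>, once the radius has come down to
  about \<open>(\<kappa> / A) ^ (n + 1)\<close>, where \<open>A\<close> is the integer part of the \<open>n\<close>-th root of \<open>Q\<close>;
  \<open>e\<close> is the radius after the previous jump.\<close>
lemma ex_target:
  fixes \<kappa> \<sigma> u e B :: real
  assumes u: "0 \<le> u" and \<sigma>: "real n * u / s < \<sigma>" and e: "0 < e" and \<kappa>: "0 < \<kappa>" and B: "0 < B"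
  obtains Q A :: nat where "1 \<le> A" "1 \<le> Q" "A ^ n \<le> Q" "Q \<le> (2 * A) ^ n"
    "\<And>q. 1 \<le> q \<Longrightarrow> q \<le> Q \<Longrightarrow> real q ^ Suc n * \<psi> q powr s \<le> real Q ^ Suc n * \<psi> Q powr s"
    "4 \<le> real A * e" "(\<kappa> / A) ^ Suc n \<le> e" "\<psi> Q * real A ^ Suc n \<le> 1"
    "(B * (\<kappa> / A) ^ Suc n / e) powr \<sigma> \<le> (\<psi> Q / 2) powr u"
proof -
  define m where "m = real (Suc n)"
  \<comment> \<open>From \<open>1 \<le> Q ^ (n + 1) * \<psi> Q powr s\<close> and
    \<open>Q \<le> (2 * A) ^ n\<close> it follows that \<open>\<psi> Q powr u\<close> is at least
    \<open>(2 * A) powr (- \<beta>)\<close>. The other side of the last claim is a constant times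
    \<open>A powr (- (m * \<sigma>))\<close>, and the assumption on \<open>\<sigma>\<close> says
    that \<open>\<beta> < m * \<sigma>\<close>.\<close>
  define \<beta> where "\<beta> = real n * m * u / s"
  have m: "0 < m" by (simp add: m_def)
  have \<beta>: "\<beta> < m * \<sigma>"
    using mult_strict_left_mono[OF \<sigma>, of m] m by (simp add: \<beta>_def mult_ac)
  have ev1: "eventually (\<lambda>A. 4 / e \<le> real A) sequentially"
    using filterlim_real_sequentially unfolding filterlim_at_top by blast
  have "(\<lambda>A. (\<kappa> / real A) ^ Suc n) \<longlonglongrightarrow> 0 ^ Suc n"
    by (intro tendsto_power lim_const_over_n)
  then have ev2: "eventually (\<lambda>A. (\<kappa> / real A) ^ Suc n < e) sequentially"
    using e by (intro order_tendstoD(2)[where y = 0]) auto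
  define c where "c = (B * \<kappa> ^ Suc n / e) powr \<sigma>"
  have ev3: "eventually (\<lambda>A. c * real A powr (- (m * \<sigma>)) \<le> (2 powr (- u) * 2 powr (- \<beta>)) * real A powr (- \<beta>)) sequentially"
    by (intro powr_mult_le_eventually \<beta>) auto
  obtain A0 where A0: "\<And>A. A0 \<le> A \<Longrightarrow> 4 / e \<le> real A \<and> (\<kappa> / real A) ^ Suc n < e \<and>
      c * real A powr (- (m * \<sigma>)) \<le> (2 powr (- u) * 2 powr (- \<beta>)) * real A powr (- \<beta>)"
    using eventually_conj[OF ev1 eventually_conj[OF ev2 ev3]] by (auto simp: eventually_sequentially)
  obtain q0 where q0: "\<And>q. q0 \<le> q \<Longrightarrow> \<psi> q ^ n * real q ^ Suc n \<le> 1"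
    using small by (auto simp: eventually_sequentially)
  \<comment> \<open>The bound \<open>A0 ^ n \<le> Q\<close> passes the largeness of \<open>Q\<close>
    on to its integer root \<open>A\<close>.\<close>
  obtain Q where Q: "1 \<le> Q" "max q0 (A0 ^ n) \<le> Q" "1 \<le> real Q ^ Suc n * \<psi> Q powr s"
    and rec: "\<And>q. 1 \<le> q \<Longrightarrow> q \<le> Q \<Longrightarrow> real q ^ Suc n * \<psi> q powr s \<le> real Q ^ Suc n * \<psi> Q powr s"
    using ex_record by metis
  obtain A where A: "1 \<le> A" "A ^ n \<le> Q" "Q < (A + 1) ^ n"
    using ex_nat_root[OF n Q(1)] by metis
  have "A0 ^ n < (A + 1) ^ n" using Q(2) A(3) by simp
  then have "A0 < A + 1" using power_less_imp_less_base[of A0 n "A + 1"] by simp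
  have A0': "4 / e \<le> real A" "(\<kappa> / real A) ^ Suc n < e"
      "c * real A powr (- (m * \<sigma>)) \<le> (2 powr (- u) * 2 powr (- \<beta>)) * real A powr (- \<beta>)"
    using A0[of A] \<open>A0 < A + 1\<close> by auto
  have \<psi>Q: "0 < \<psi> Q" using pos[OF Q(1)] .
  have "(A + 1) ^ n \<le> (2 * A) ^ n" using A(1) by (intro power_mono) auto
  then have QA: "Q \<le> (2 * A) ^ n" using A(3) by simp
  have "(\<psi> Q * real A ^ Suc n) ^ n = \<psi> Q ^ n * (real A ^ n) ^ Suc n"
    by (simp only: power_mult_distrib flip: power_mult) (simp add: mult.commute)
  also have "\<dots> \<le> \<psi> Q ^ n * real Q ^ Suc n"
  proof (intro mult_left_mono power_mono)
    show "real A ^ n \<le> real Q" using A(2) by (metis of_nat_le_iff of_nat_power)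
  qed (use \<psi>Q in auto)
  also have "\<dots> \<le> 1 ^ n" using q0[of Q] Q(2) by simp
  finally have small: "\<psi> Q * real A ^ Suc n \<le> 1"
    using n \<psi>Q by (subst (asm) power_mono_iff) auto
  have A': "0 < real A" using A by simp
  have eq: "B * (\<kappa> / A) ^ Suc n / e = (B * \<kappa> ^ Suc n / e) * real A powr (- m)"
    using A' by (simp add: m_def power_divide powr_minus_divide powr_realpow del: power_Suc of_nat_Suc)
  have "(B * (\<kappa> / A) ^ Suc n / e) powr \<sigma> = c * real A powr (- (m * \<sigma>))"
    unfolding eq using B \<kappa> e by (subst powr_mult) (simp_all add: c_def powr_powr del: power_Suc)
  also have "\<dots> \<le> (2 powr (- u) * 2 powr (- \<beta>)) * real A powr (- \<beta>)" by (rule A0')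
  also have "\<dots> = 2 powr (- u) * (2 * real A) powr (- \<beta>)"
    using A' by (simp add: powr_mult)
  also have "\<dots> = 2 powr (- u) * ((2 * real A) powr (- (real n * m))) powr (u / s)"
    by (simp add: powr_powr \<beta>_def)
  also have "\<dots> \<le> 2 powr (- u) * (\<psi> Q powr s) powr (u / s)"
  proof (intro mult_left_mono powr_mono2)
    have "real Q \<le> (2 * real A) ^ n" using QA by (metis of_nat_le_iff of_nat_mult of_nat_numeral of_nat_power)
    then have "real Q ^ Suc n \<le> ((2 * real A) ^ n) ^ Suc n" by (intro power_mono) auto
    also have "\<dots> = (2 * real A) ^ (n * Suc n)" by (rule power_mult[symmetric])
    also have "\<dots> = (2 * real A) powr real (n * Suc n)"
      using A' by (intro powr_realpow[symmetric]) auto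
    also have "real (n * Suc n) = real n * m" by (simp only: m_def of_nat_mult)
    finally have "real Q ^ Suc n * \<psi> Q powr s \<le> (2 * real A) powr (real n * m) * \<psi> Q powr s"
      by (intro mult_right_mono) auto
    then have "1 \<le> (2 * real A) powr (real n * m) * \<psi> Q powr s" using Q(3) by linarith
    then show "(2 * real A) powr (- (real n * m)) \<le> \<psi> Q powr s"
      using A' by (simp add: powr_minus field_simps)
  qed (use u s in auto)
  also have "\<dots> = (\<psi> Q / 2) powr u"
    using s \<psi>Q by (simp add: powr_powr powr_divide powr_minus field_simps)
  finally have mass: "(B * (\<kappa> / A) ^ Suc n / e) powr \<sigma> \<le> (\<psi> Q / 2) powr u" .
  show ?thesis
    using that[of A Q, OF A(1) Q(1) A(2) QA rec _ _ small mass] A0' e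
    by (simp add: field_simps)
qed

end

context approximation_function
begin

text \<open>A state consists of the current radius and of the radius after the most recent jump, which
  determines the data \<open>A\<close> and \<open>Q\<close> of the next jump.\<close>
lemma ex_schedule:
  fixes u :: real and N :: nat
  defines "\<kappa> \<equiv> 64 * real N * (2 * real n + 1)"
  assumes N: "2 \<le> N" and u: "0 \<le> u" "real n * u / s < real n * ln N / ln (16 * N)"
  obtains \<rho> :: "nat \<Rightarrow> real" and J A Q and C :: real where
    "\<rho> 0 = 1" "\<And>j. 0 < \<rho> j"
    "\<And>j. Suc j \<notin> J \<Longrightarrow> \<rho> (Suc j) = \<rho> j / (16 * N)"
    "\<And>j. Suc j \<in> J \<Longrightarrow> \<rho> (Suc j) \<le> \<rho> j / (32 * N)"
    "\<And>j. Suc j \<in> J \<Longrightarrow> \<rho> (Suc j) = \<psi> (Q j) / 2"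
    "\<And>j. Suc j \<in> J \<Longrightarrow> 1 \<le> A j"
    "\<And>j. Suc j \<in> J \<Longrightarrow> A j ^ n \<le> Q j"
    "\<And>j. Suc j \<in> J \<Longrightarrow> \<kappa> \<le> real (A j) * root (Suc n) (\<rho> j)"
    "\<And>i j. \<lbrakk>Suc j \<in> J; i \<le> j; i \<in> insert 0 J\<rbrakk> \<Longrightarrow> 4 \<le> real (A j) * \<rho> i"
    "0 < C" "\<And>j q. \<lbrakk>Suc j \<in> J; 1 \<le> q; \<not> low_denominator n (\<rho> j) q\<rbrakk> \<Longrightarrow> \<psi> q \<le> C * \<psi> (Q j)"
    "\<And>j. \<exists>k\<ge>j. Suc k \<in> J"
    "\<And>j. 1 / real (N ^ n) ^ j \<le> \<rho> j powr u"
proof -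
  \<comment> \<open>The similarity dimension of the construction without jumps: each ball has
    \<open>N ^ n\<close> children, smaller by the factor \<open>16 * N\<close>.\<close>
  define \<sigma> where "\<sigma> = real n * ln N / ln (16 * N)"
  have \<kappa>: "64 * real N \<le> \<kappa>"
    unfolding \<kappa>_def using mult_left_mono[of 1 "2 * real n + 1" "64 * real N"] by simp
  then have \<kappa>0: "0 < \<kappa>" using N by linarith
  have ln_pos: "0 < ln (16 * real N)" using N by simp
  have \<sigma>0: "0 < \<sigma>" unfolding \<sigma>_def using N n by (intro divide_pos_pos mult_pos_pos) auto
  have \<sigma>: "(16 * real N) powr \<sigma> = real N ^ n"
  proof -
    have "(16 * real N) powr \<sigma> = exp (real n * ln N)"
      using N ln_pos by (simp add: powr_def \<sigma>_def)
    then show ?thesis using N by (simp add: exp_of_nat_mult)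
  qed
  have u\<sigma>: "u \<le> \<sigma>"
  proof -
    have "u * s \<le> u * real n" using u s_less_n by (intro mult_left_mono) auto
    then have "u \<le> real n * u / s" using s by (simp add: field_simps)
    then show ?thesis using u by (simp add: \<sigma>_def)
  qed
  define good where "good = (\<lambda>e A Q. 1 \<le> A \<and> 1 \<le> Q \<and> A ^ n \<le> Q \<and> Q \<le> (2 * A) ^ n \<and>
    (\<forall>q. 1 \<le> q \<longrightarrow> q \<le> Q \<longrightarrow> real q ^ Suc n * \<psi> q powr s \<le> real Q ^ Suc n * \<psi> Q powr s) \<and>
    4 \<le> real A * e \<and> (\<kappa> / A) ^ Suc n \<le> e \<and> \<psi> Q * real A ^ Suc n \<le> 1 \<and>
    (16 * real N * (\<kappa> / A) ^ Suc n / e) powr \<sigma> \<le> (\<psi> Q / 2) powr u)"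
  have ex: "\<exists>A Q. good e A Q" if "0 < e" for e
  proof -
    have "0 < 16 * real N" using N by simp
    from ex_target[OF u(1) _ that \<kappa>0 this, of \<sigma>] u(2) show ?thesis
      unfolding good_def \<sigma>_def by metis
  qed
  then obtain Af Qf where "\<And>e. 0 < e \<Longrightarrow> good e (Af e) (Qf e)" by metis
  then have Af: "1 \<le> Af e" and Qf: "1 \<le> Qf e" and AQ: "Af e ^ n \<le> Qf e" and QA: "Qf e \<le> (2 * Af e) ^ n"
    and rec: "\<And>q. 1 \<le> q \<Longrightarrow> q \<le> Qf e \<Longrightarrow> real q ^ Suc n * \<psi> q powr s \<le> real (Qf e) ^ Suc n * \<psi> (Qf e) powr s"
    and Ae: "4 \<le> real (Af e) * e" and \<kappa>e: "(\<kappa> / Af e) ^ Suc n \<le> e" and \<psi>A: "\<psi> (Qf e) * real (Af e) ^ Suc n \<le> 1"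
    and mass: "(16 * real N * (\<kappa> / Af e) ^ Suc n / e) powr \<sigma> \<le> (\<psi> (Qf e) / 2) powr u"
    if "0 < e" for e
    using that unfolding good_def by blast+
  \<comment> \<open>The threshold \<open>(\<kappa> / A) ^ (n + 1)\<close> is the smallest radius
    \<open>r\<close> with \<open>\<kappa> \<le> A * root (n + 1) r\<close>. A jump is made when an
    ordinary step would fall below it, so the radius before a jump is within a factor
    \<open>16 * N\<close> of the threshold.\<close>
  define next_state where "next_state = (\<lambda>(r, e). if (\<kappa> / Af e) ^ Suc n \<le> r / (16 * N) then (r / (16 * N), e)
      else (\<psi> (Qf e) / 2, \<psi> (Qf e) / 2))"
  define state :: "nat \<Rightarrow> real \<times> real" where "state = rec_nat (1, 1) (\<lambda>_. next_state)"
  define \<rho> where "\<rho> = (\<lambda>j. fst (state j))"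
  define \<epsilon> where "\<epsilon> = (\<lambda>j. snd (state j))"
  define J where "J = {Suc j | j. \<not> (\<kappa> / Af (\<epsilon> j)) ^ Suc n \<le> \<rho> j / (16 * N)}"
  define A where "A = (\<lambda>j. Af (\<epsilon> j))"
  define Q where "Q = (\<lambda>j. Qf (\<epsilon> j))"
  have J: "Suc j \<in> J \<longleftrightarrow> \<not> (\<kappa> / A j) ^ Suc n \<le> \<rho> j / (16 * N)" for j
    by (simp add: J_def A_def)
  have start: "\<rho> 0 = 1" "\<epsilon> 0 = 1" by (simp_all add: \<rho>_def \<epsilon>_def state_def)
  have normal: "\<rho> (Suc j) = \<rho> j / (16 * N)" "\<epsilon> (Suc j) = \<epsilon> j" if "Suc j \<notin> J" for j
    using that by (simp_all add: J A_def \<rho>_def \<epsilon>_def state_def next_state_def case_prod_unfold del: power_Suc)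
  have jump: "\<rho> (Suc j) = \<psi> (Q j) / 2" "\<epsilon> (Suc j) = \<psi> (Q j) / 2" if "Suc j \<in> J" for j
    using that by (simp_all add: J A_def Q_def \<rho>_def \<epsilon>_def state_def next_state_def case_prod_unfold del: power_Suc)
  have inv: "0 < \<rho> j \<and> \<rho> j \<le> \<epsilon> j \<and> (\<kappa> / A j) ^ Suc n \<le> \<rho> j" for j
  proof (induction j)
    case 0
    show ?case using \<kappa>e[of 1] by (simp add: start A_def del: power_Suc)
  next
    case (Suc j)
    show ?case
    proof (cases "Suc j \<in> J")
      case True
      have "0 < \<psi> (Q j)" using pos Qf[of "\<epsilon> j"] Suc by (auto simp: Q_def)
      then show ?thesis using \<kappa>e[of "\<psi> (Q j) / 2"] by (simp add: jump[OF True] A_def del: power_Suc)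
    next
      case False
      have "\<rho> j / (16 * N) \<le> \<rho> j / 1" using N Suc by (intro divide_left_mono) auto
      then show ?thesis using False N Suc J[of j] by (simp add: normal[OF False] A_def del: power_Suc)
    qed
  qed
  have \<epsilon>0: "0 < \<epsilon> j" for j using inv[of j] by linarith
  have \<psi>Q: "0 < \<psi> (Q j)" for j using pos Qf \<epsilon>0 by (auto simp: Q_def)
  have A1: "1 \<le> A j" for j using Af \<epsilon>0 by (simp add: A_def)
  have A0: "0 < real (A j)" for j using A1[of j] by linarith
  \<comment> \<open>Since \<open>\<psi> Q * A ^ (n + 1) \<le> 1\<close> and
    \<open>\<kappa> \<ge> 64 * N\<close>, the new radius lies well below the threshold, and by
    \<open>inv\<close> the current radius is at least the threshold.\<close>
  have jump_le: "\<rho> (Suc j) \<le> \<rho> j / (32 * N)" if "Suc j \<in> J" for j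
  proof -
    have "\<kappa> ^ 1 \<le> \<kappa> ^ Suc n" using \<kappa> N by (intro power_increasing) auto
    then have "64 * real N * \<psi> (Q j) \<le> \<kappa> ^ Suc n * \<psi> (Q j)"
      using \<kappa> \<psi>Q[of j] by (intro mult_right_mono) auto
    also have "\<dots> = (\<kappa> / A j) ^ Suc n * (\<psi> (Q j) * real (A j) ^ Suc n)"
      using A0[of j] by (simp add: power_divide)
    also have "\<dots> \<le> (\<kappa> / A j) ^ Suc n * 1"
      using \<psi>A[OF \<epsilon>0, of j] \<kappa>0 by (intro mult_left_mono) (auto simp: Q_def A_def)
    also have "\<dots> \<le> \<rho> j" using inv[of j] by simp
    finally have "32 * real N * \<psi> (Q j) \<le> \<rho> j * 2" using \<psi>Q[of j] inv[of j] by linarith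
    then show ?thesis using N by (simp add: jump[OF that] field_simps)
  qed
  have \<rho>_le: "\<rho> (Suc j) \<le> \<rho> j / (16 * N)" for j
  proof (cases "Suc j \<in> J")
    case True
    have "\<rho> j / (32 * N) \<le> \<rho> j / (16 * N)"
      using N inv[of j] by (intro divide_left_mono) auto
    then show ?thesis using jump_le[OF True] by linarith
  qed (simp add: normal)
  have \<rho>_le': "\<rho> (Suc j) \<le> \<rho> j / 2" for j
  proof -
    have "\<rho> j / (16 * N) \<le> \<rho> j / 2"
      using N inv[of j] by (intro divide_left_mono) auto
    then show ?thesis using \<rho>_le[of j] by linarith
  qed
  have \<epsilon>_mono: "\<epsilon> j \<le> \<epsilon> i" if "i \<le> j" for i j
    using that
  proof (induction rule: dec_induct)
    case (step j)
    have "\<epsilon> (Suc j) \<le> \<epsilon> j"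
    proof (cases "Suc j \<in> J")
      case True
      then have "\<epsilon> (Suc j) = \<rho> (Suc j)" by (simp add: jump)
      also have "\<dots> \<le> \<rho> j" using \<rho>_le'[of j] inv[of j] by linarith
      finally show ?thesis using inv[of j] by linarith
    qed (simp add: normal)
    then show ?case using step by simp
  qed simp
  \<comment> \<open>Without further jumps \<open>\<epsilon>\<close>, and with it \<open>A\<close>,
    would stay constant while the radii tend to 0, against the lower bound in
    \<open>inv\<close>.\<close>
  have infinite_jumps: "\<exists>k\<ge>j. Suc k \<in> J" for j
  proof (rule ccontr)
    assume "\<not> ?thesis"
    then have no: "Suc (j + i) \<notin> J" for i by auto
    have \<epsilon>: "\<epsilon> (j + i) = \<epsilon> j" for i by (induction i) (simp_all add: normal no)
    have le: "\<rho> (j + i) \<le> \<rho> j * (1 / 2) ^ i" for i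
    proof (induction i)
      case (Suc i)
      then show ?case using \<rho>_le'[of "j + i"] by simp
    qed simp
    have "(\<lambda>i. \<rho> j * (1 / 2) ^ i) \<longlonglongrightarrow> \<rho> j * 0"
      by (intro tendsto_intros LIMSEQ_realpow_zero) auto
    moreover have "(\<kappa> / A j) ^ Suc n \<le> \<rho> j * (1 / 2) ^ i" for i
      using inv[of "j + i"] \<epsilon>[of i] le[of i] by (simp add: A_def)
    ultimately have "(\<kappa> / A j) ^ Suc n \<le> \<rho> j * 0"
      by (intro LIMSEQ_le_const) auto
    moreover have "0 < (\<kappa> / A j) ^ Suc n" using \<kappa>0 A0[of j] by (intro zero_less_power divide_pos_pos)
    ultimately show False by simp
  qed
  have A_root: "\<kappa> \<le> real (A j) * root (Suc n) (\<rho> j)" for j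
  proof -
    have "\<kappa> / A j = root (Suc n) ((\<kappa> / A j) ^ Suc n)"
      using \<kappa>0 A0[of j] by (intro real_root_power_cancel[symmetric]) auto
    also have "\<dots> \<le> root (Suc n) (\<rho> j)" using inv[of j] by simp
    finally show ?thesis using A0[of j] by (simp add: field_simps)
  qed
  have A_radius: "4 \<le> real (A j) * \<rho> i" if "i \<le> j" "i \<in> insert 0 J" for i j
  proof -
    \<comment> \<open>The two components of the state agree at level 0 and directly after a
      jump.\<close>
    have "\<rho> i = \<epsilon> i" using that(2) by (cases i) (auto simp: start jump)
    then have "\<epsilon> j \<le> \<rho> i" using \<epsilon>_mono[OF that(1)] by simp
    then have "real (A j) * \<epsilon> j \<le> real (A j) * \<rho> i" by (intro mult_left_mono) auto
    then show ?thesis using Ae[OF \<epsilon>0, of j] by (simp add: A_def)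
  qed
  have powr16: "(x / (16 * real N)) powr a = x powr a / (16 * real N) powr a" for x a
    by (rule powr_divide)
  \<comment> \<open>The second bound alone would not survive a jump, where the radius may drop
    sharply while the number of balls grows by only one factor. The first bound stores the number of
    balls gained since the last jump: ordinary steps scale both of its sides equally,
    \<open>mass\<close> converts it into the second bound at the next jump, and after the jump its
    ratio is 1.\<close>
  have weight: "1 / real (N ^ n) ^ j \<le> (\<rho> j / \<epsilon> j) powr \<sigma> \<and> 1 / real (N ^ n) ^ j \<le> \<rho> j powr u" for j
  proof (induction j)
    case 0
    show ?case by (simp add: start)
  next
    case (Suc j)
    have step: "1 / real (N ^ n) ^ Suc j = 1 / real (N ^ n) ^ j / (16 * real N) powr \<sigma>"
      by (simp add: \<sigma>)
    have Npos: "0 < (16 * real N) powr \<sigma>" using N by simp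
    show ?case
    proof (cases "Suc j \<in> J")
      case False
      have "\<rho> (Suc j) / \<epsilon> (Suc j) = \<rho> j / \<epsilon> j / (16 * real N)"
        by (simp add: normal[OF False])
      then have eq: "(\<rho> (Suc j) / \<epsilon> (Suc j)) powr \<sigma> = (\<rho> j / \<epsilon> j) powr \<sigma> / (16 * real N) powr \<sigma>"
        using powr16[of "\<rho> j / \<epsilon> j" \<sigma>] inv[of j] \<epsilon>0[of j] by simp
      have 1: "1 / real (N ^ n) ^ Suc j \<le> (\<rho> (Suc j) / \<epsilon> (Suc j)) powr \<sigma>"
        unfolding step eq using Suc Npos by (intro divide_right_mono) auto
      have "1 / real (N ^ n) ^ Suc j \<le> \<rho> j powr u / (16 * real N) powr \<sigma>"
        unfolding step using Suc Npos by (intro divide_right_mono) auto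
      also have "\<dots> \<le> \<rho> j powr u / (16 * real N) powr u"
        using N u\<sigma> by (intro divide_left_mono powr_mono) auto
      also have "\<dots> = \<rho> (Suc j) powr u"
        using powr16[of "\<rho> j" u] inv[of j] by (simp add: normal[OF False])
      finally show ?thesis using 1 by blast
    next
      case True
      have N1: "1 \<le> real (N ^ n)" using N by simp
      have le1: "1 / real (N ^ n) ^ Suc j \<le> 1 / real (N ^ n) ^ j"
        using N1 N by (intro divide_left_mono power_increasing) auto
      also have "\<dots> \<le> (\<rho> j / \<epsilon> j) powr \<sigma>" using Suc by blast
      also have "\<dots> \<le> (16 * real N * (\<kappa> / A j) ^ Suc n / \<epsilon> j) powr \<sigma>"
      proof (intro powr_mono2 divide_right_mono)
        have "\<rho> j / (16 * N) \<le> (\<kappa> / A j) ^ Suc n" using True J[of j] by simp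
        then show "\<rho> j \<le> 16 * real N * (\<kappa> / A j) ^ Suc n" using N by (simp add: field_simps)
      qed (use \<sigma>0 \<epsilon>0[of j] inv[of j] in auto)
      also have "\<dots> \<le> (\<psi> (Q j) / 2) powr u" using mass[OF \<epsilon>0, of j] by (simp add: A_def Q_def)
      finally have "1 / real (N ^ n) ^ Suc j \<le> \<rho> (Suc j) powr u" by (simp add: jump[OF True])
      moreover have "1 / x \<le> 1" if "1 \<le> x" for x :: real using that by simp
      then have "1 / real (N ^ n) ^ Suc j \<le> 1" using one_le_power[OF N1] by blast
      then have "1 / real (N ^ n) ^ Suc j \<le> (\<rho> (Suc j) / \<epsilon> (Suc j)) powr \<sigma>"
        using \<psi>Q[of j] by (simp add: jump[OF True] del: power_Suc of_nat_power)
      ultimately show ?thesis by blast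
    qed
  qed
  \<comment> \<open>\<open>D\<close> will bound \<open>Q j / q\<close> for \<open>q\<close> not low
    at level \<open>j\<close> just before a jump; \<open>C\<close> arises from it by taking the
    \<open>s\<close>-th root of the record inequality.\<close>
  define D where "D = (2 * real n + 1) * (32 * real N * \<kappa>) ^ n"
  have "1 * 1 \<le> D" unfolding D_def
  proof (intro mult_mono one_le_power)
    show "1 \<le> 32 * real N * \<kappa>" using \<kappa> N mult_mono[of 1 "32 * real N" 1 \<kappa>] by simp
  qed auto
  then have D1: "1 \<le> D" by simp
  define C where "C = D powr (real (Suc n) / s)"
  have C1: "1 \<le> C" unfolding C_def using D1 s by (intro ge_one_powr_ge_zero) auto
  have comparable: "\<psi> q \<le> C * \<psi> (Q j)" if j: "Suc j \<in> J" and q: "1 \<le> q" "\<not> low_denominator n (\<rho> j) q" for q j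
  proof (cases "q \<le> Q j")
    case False
    then have "\<psi> q \<le> 1 * \<psi> (Q j)" using antimono[of "Q j" q] Qf[OF \<epsilon>0] by (simp add: Q_def)
    also have "\<dots> \<le> C * \<psi> (Q j)" using C1 \<psi>Q[of j] by (intro mult_right_mono) auto
    finally show ?thesis .
  next
    case True
    \<comment> \<open>The factor \<open>16 * N\<close> is enlarged to its \<open>(n + 1)\<close>-st
      power so that the right-hand side is a perfect power before the root is taken.\<close>
    have "\<rho> j \<le> (16 * real N) ^ Suc n * (\<kappa> / A j) ^ Suc n"
    proof -
      have "\<rho> j / (16 * N) \<le> (\<kappa> / A j) ^ Suc n" using j J[of j] by simp
      then have "\<rho> j \<le> (16 * real N) ^ 1 * (\<kappa> / A j) ^ Suc n" using N by (simp add: field_simps)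
      also have "\<dots> \<le> (16 * real N) ^ Suc n * (\<kappa> / A j) ^ Suc n"
        using N \<kappa>0 by (intro mult_right_mono power_increasing) auto
      finally show ?thesis .
    qed
    then have "\<rho> j \<le> (16 * real N * (\<kappa> / A j)) ^ Suc n" by (simp only: power_mult_distrib)
    then have "root (Suc n) (\<rho> j) \<le> root (Suc n) ((16 * real N * (\<kappa> / A j)) ^ Suc n)"
      by (intro real_root_le_mono) auto
    also have "\<dots> = 16 * real N * (\<kappa> / A j)"
      using \<kappa>0 by (intro real_root_power_cancel) auto
    finally have "root (Suc n) (\<rho> j) ^ n \<le> (16 * real N * (\<kappa> / A j)) ^ n"
      using inv[of j] by (intro power_mono) auto
    then have "(2 * real n + 1) * real q * root (Suc n) (\<rho> j) ^ n
        \<le> (2 * real n + 1) * real q * (16 * real N * (\<kappa> / A j)) ^ n"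
      by (intro mult_left_mono) auto
    then have "1 \<le> (2 * real n + 1) * real q * (16 * real N * (\<kappa> / A j)) ^ n"
      using q(2) unfolding low_denominator_def by linarith
    then have "(2 * real (A j)) ^ n * 1 \<le> (2 * real (A j)) ^ n * ((2 * real n + 1) * real q * (16 * real N * (\<kappa> / A j)) ^ n)"
      by (intro mult_left_mono) auto
    also have "\<dots> = D * real q"
    proof -
      have "32 * real N * \<kappa> = 2 * real (A j) * (16 * real N * (\<kappa> / A j))" using A0[of j] by simp
      then have "(32 * real N * \<kappa>) ^ n = (2 * real (A j)) ^ n * (16 * real N * (\<kappa> / A j)) ^ n"
        by (simp only: power_mult_distrib)
      then show ?thesis by (simp add: D_def)
    qed
    also have "(2 * real (A j)) ^ n * 1 = real ((2 * A j) ^ n)" by simp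
    finally have QD: "real (Q j) \<le> D * real q"
      using QA[OF \<epsilon>0, of j] of_nat_mono[of "Q j" "(2 * A j) ^ n", where 'a = real]
      by (simp add: Q_def A_def)
    \<comment> \<open>For \<open>q \<le> Q j\<close>, monotonicity points the wrong way; the record
      property replaces it, at the cost of the bounded ratio \<open>Q j / q\<close>.\<close>
    have "real q ^ Suc n * \<psi> q powr s \<le> real (Q j) ^ Suc n * \<psi> (Q j) powr s"
      using rec[OF \<epsilon>0 q(1)] True by (simp add: Q_def)
    also have "\<dots> \<le> (D * real q) ^ Suc n * \<psi> (Q j) powr s"
      using QD by (intro mult_right_mono power_mono) auto
    also have "\<dots> = real q ^ Suc n * (D ^ Suc n * \<psi> (Q j) powr s)" by (simp only: power_mult_distrib mult_ac)
    finally have "\<psi> q powr s \<le> D ^ Suc n * \<psi> (Q j) powr s"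
      using q(1) by (subst (asm) mult_le_cancel_left_pos) auto
    then have "(\<psi> q powr s) powr (1 / s) \<le> (D ^ Suc n * \<psi> (Q j) powr s) powr (1 / s)"
      using s by (intro powr_mono2) auto
    also have "\<dots> = (D powr real (Suc n)) powr (1 / s) * (\<psi> (Q j) powr s) powr (1 / s)"
      using D1 by (subst powr_realpow) (auto simp: powr_mult)
    also have "\<dots> = C * \<psi> (Q j)" using s \<psi>Q[of j] by (simp add: powr_powr C_def del: of_nat_Suc)
    finally show ?thesis using s pos[OF q(1)] by (simp add: powr_powr)
  qed
  show ?thesis
  proof (rule that[of \<rho> J Q A C])
    show "\<rho> 0 = 1" by (rule start)
    show "0 < C" using C1 by linarith
    show "0 < \<rho> j" for j using inv by blast
    show "A j ^ n \<le> Q j" for j using AQ \<epsilon>0 by (simp add: A_def Q_def)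
  qed (use normal jump jump_le A1 A_root A_radius comparable infinite_jumps weight in blast)+
qed

end

section \<open>Lower bound for badly approximable points\<close>

lemma ex_index_bound:
  fixes f :: "nat \<Rightarrow> real"
  assumes "eventually (\<lambda>q. f q \<le> 1) sequentially" "\<And>q. 1 \<le> q \<Longrightarrow> 0 \<le> f q"
  obtains K where "1 \<le> K" "\<And>q. 1 \<le> q \<Longrightarrow> f q \<le> K"
proof -
  obtain q0 where q0: "\<And>q. q0 \<le> q \<Longrightarrow> f q \<le> 1"
    using assms(1) by (auto simp: eventually_sequentially)
  define K where "K = 1 + (\<Sum>q\<in>{1..<q0}. f q)"
  have K1: "1 \<le> K" unfolding K_def using assms(2) by (auto intro!: sum_nonneg)
  moreover have "f q \<le> K" if "1 \<le> q" for q
  proof (cases "q0 \<le> q")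
    case True
    then show ?thesis using q0[OF True] K1 by linarith
  next
    case False
    then have "f q \<le> (\<Sum>q\<in>{1..<q0}. f q)"
      using that assms(2) by (intro member_le_sum) auto
    then show ?thesis by (simp add: K_def)
  qed
  ultimately show ?thesis using that by blast
qed

text \<open>The \<open>(n + 1)\<close>-st power of the negated \<open>low_denominator\<close> reads
  \<open>1 \<le> q ^ (n + 1) * b ^ (n + 1) * r ^ n\<close> with \<open>b = 2 * n + 1\<close>, and
  \<open>\<psi> q ^ n * q ^ (n + 1)\<close> is bounded by \<open>small\<close>. This handles
  denominators that become low at an ordinary step.\<close>

lemma (in approximation_function) le_radius_of_high_denominator:
  obtains K where "0 < K"
    "\<And>q r. \<lbrakk>1 \<le> q; 0 < r; \<not> low_denominator n r q\<rbrakk> \<Longrightarrow> \<psi> q \<le> K * r"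
proof -
  obtain K where K: "1 \<le> K" "\<And>q. 1 \<le> q \<Longrightarrow> \<psi> q ^ n * real q ^ Suc n \<le> K"
    using ex_index_bound[OF small] pos by (metis less_imp_le mult_nonneg_nonneg of_nat_0_le_iff zero_le_power)
  define b where "b = 2 * real n + 1"
  have b: "1 \<le> b" by (simp add: b_def)
  have "\<psi> q \<le> K * b\<^sup>2 * r" if q: "1 \<le> q" and r: "0 < r" and high: "\<not> low_denominator n r q" for q r
  proof -
    define h where "h = root (Suc n) r"
    have h: "0 < h" "h ^ Suc n = r" using r by (simp_all add: h_def del: power_Suc)
    have "1 ^ Suc n \<le> (b * real q * h ^ n) ^ Suc n"
      using high by (intro power_mono) (auto simp: low_denominator_def b_def h_def)
    also have "\<dots> = real q ^ Suc n * (b ^ Suc n * (h ^ Suc n) ^ n)"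
      by (simp only: power_mult_distrib mult_ac flip: power_mult)
    finally have "\<psi> q ^ n * 1 \<le> \<psi> q ^ n * (real q ^ Suc n * (b ^ Suc n * r ^ n))"
      using pos[OF q] unfolding h by (intro mult_left_mono) auto
    also have "\<dots> = (\<psi> q ^ n * real q ^ Suc n) * (b ^ Suc n * r ^ n)" by simp
    also have "\<dots> \<le> K ^ 1 * (b ^ Suc n * r ^ n)"
      using K(2)[OF q] b r by (intro mult_right_mono) auto
    \<comment> \<open>Both \<open>K\<close> and \<open>b\<close> are at least 1, so their exponents
      may be raised to multiples of \<open>n\<close>; then the \<open>n\<close>-th root is
      available.\<close>
    also have "\<dots> \<le> K ^ n * (b ^ (2 * n) * r ^ n)"
      using K(1) b r n by (intro mult_mono mult_right_mono power_increasing mult_nonneg_nonneg) auto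
    also have "\<dots> = (K * b\<^sup>2 * r) ^ n"
      by (simp add: power_mult_distrib power_mult)
    finally show ?thesis
      using n K(1) b r pos[OF q] by (subst (asm) mult_1_right, subst (asm) power_mono_iff) auto
  qed
  moreover have "0 < K * b\<^sup>2" using K b by simp
  ultimately show ?thesis using that by blast
qed

text \<open>The quotient tends to \<open>n\<close>, because the factor 16 only adds a constant to
  the logarithm.\<close>

lemma ex_branching_number:
  assumes "0 \<le> a" "a < real n"
  obtains N :: nat where "2 \<le> N" "a < real n * ln N / ln (16 * N)"
proof -
  have "filterlim (\<lambda>N. ln (real N)) at_top sequentially"
    by (rule filterlim_compose[OF ln_at_top filterlim_real_sequentially])
  then have "eventually (\<lambda>N. a * ln 16 / (real n - a) < ln (real N)) sequentially"
    by (simp add: filterlim_at_top_dense)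
  then have "eventually (\<lambda>N. 2 \<le> N \<and> a * ln 16 / (real n - a) < ln (real N)) sequentially"
    using eventually_ge_at_top[of 2] by eventually_elim simp
  then obtain N :: nat where N: "2 \<le> N" "a * ln 16 / (real n - a) < ln (real N)"
    by (auto dest: eventually_happens)
  have "a * (ln 16 + ln (real N)) < real n * ln (real N)"
    using N(2) assms by (simp add: field_simps)
  moreover have "ln (16 * real N) = ln 16 + ln (real N)" using N(1) by (simp add: ln_mult)
  moreover have "0 < ln (16 * real N)" using N(1) by simp
  ultimately have "a < real n * ln N / ln (16 * N)" by (simp add: field_simps)
  then show ?thesis using that[of N] N(1) by simp
qed

lemma card_bounded_functions: "card {k :: 'n::finite \<Rightarrow> nat. \<forall>i. k i < N} = N ^ CARD('n)"
proof -
  have "{k :: 'n \<Rightarrow> nat. \<forall>i. k i < N} = (UNIV :: 'n set) \<rightarrow>\<^sub>E {..<N}"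
    by (auto simp: PiE_def)
  then show ?thesis by (simp add: card_funcsetE)
qed

text \<open>The base-\<open>N ^ n\<close> digits of \<open>t\<close> select the children. If two
  expansions first differ at digit \<open>j\<close>, the parameters are within
  \<open>1 / (N ^ n) ^ j \<le> \<rho> j powr u\<close>, while the points are at least
  \<open>\<rho> j / (8 * N)\<close> apart; this is the condition of
  \<open>hausdorff_measure_pos\<close>.\<close>

lemma hausdorff_measure_badly_approximable_pos:
  fixes \<psi> :: "nat \<Rightarrow> real"
  assumes "approximation_function \<psi> CARD('n) s" and u: "0 \<le> u" "u < s"
  shows "hausdorff_measure max_dist u (badly_approximable \<psi> :: (real ^ 'n::finite) set) \<noteq> 0"
proof -
  interpret approximation_function \<psi> "CARD('n)" s by fact
  let ?n = "CARD('n)"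
  have "real ?n * u / s < real ?n" using u s by (simp add: field_simps)
  then obtain N :: nat where branching: "2 \<le> N" "real ?n * u / s < real ?n * ln N / ln (16 * N)"
    using ex_branching_number[of "real ?n * u / s"] u s by (metis divide_nonneg_pos mult_nonneg_nonneg of_nat_0_le_iff)
  obtain \<rho> :: "nat \<Rightarrow> real" and J Q A C where sch:
    "\<rho> 0 = 1" "\<And>j. 0 < \<rho> j"
    "\<And>j. Suc j \<notin> J \<Longrightarrow> \<rho> (Suc j) = \<rho> j / (16 * N)"
    "\<And>j. Suc j \<in> J \<Longrightarrow> \<rho> (Suc j) \<le> \<rho> j / (32 * N)"
    "\<And>j. Suc j \<in> J \<Longrightarrow> \<rho> (Suc j) = \<psi> (Q j) / 2"
    "\<And>j. Suc j \<in> J \<Longrightarrow> 1 \<le> A j"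
    "\<And>j. Suc j \<in> J \<Longrightarrow> A j ^ ?n \<le> Q j"
    "\<And>j. Suc j \<in> J \<Longrightarrow> 64 * real N * (2 * real ?n + 1) \<le> real (A j) * root (Suc ?n) (\<rho> j)"
    "\<And>i j. \<lbrakk>Suc j \<in> J; i \<le> j; i \<in> insert 0 J\<rbrakk> \<Longrightarrow> 4 \<le> real (A j) * \<rho> i"
    "0 < C" "\<And>j q. \<lbrakk>Suc j \<in> J; 1 \<le> q; \<not> low_denominator ?n (\<rho> j) q\<rbrakk> \<Longrightarrow> \<psi> q \<le> C * \<psi> (Q j)"
    "\<And>j. \<exists>k\<ge>j. Suc k \<in> J"
    "\<And>j. 1 / real (N ^ ?n) ^ j \<le> \<rho> j powr u"
    by (rule ex_schedule[OF branching(1) u(1) branching(2)]) (rule that)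
  have N1: "1 \<le> N" using branching(1) by simp
  interpret nested_balls "0 :: real ^ 'n" \<rho> J A N
    by unfold_locales (rule N1 sch(1,2,3,4,6,8,9); assumption?)+
  define M where "M = N ^ ?n"
  have M: "2 \<le> M" using branching(1) self_le_power[of N ?n] N1 unfolding M_def by force
  obtain v :: "nat \<Rightarrow> 'n \<Rightarrow> nat" where v: "bij_betw v {..<M} {k. \<forall>i. k i < N}"
  proof -
    have "finite {k :: 'n \<Rightarrow> nat. \<forall>i. k i < N}"
      using card_bounded_functions[where 'n = 'n, of N] branching(1) by (intro card_ge_0_finite) simp
    then show ?thesis
      using ex_bij_betw_nat_finite[of "{k :: 'n \<Rightarrow> nat. \<forall>i. k i < N}"] that
      by (auto simp: card_bounded_functions M_def atLeast0LessThan)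
  qed
  define \<sigma> where "\<sigma> = (\<lambda>(t :: real) j. v (nat \<lfloor>t * real M ^ Suc j\<rfloor> mod M))"
  have \<sigma>: "\<sigma> t j i < N" for t j i
    using bij_betwE[OF v] M by (auto simp: \<sigma>_def)
  define X where "X = (\<lambda>t. point (\<sigma> t))"
  have far: "\<rho> j / 4 \<le> max_dist (X t) (rat_point p q)"
    if "1 \<le> q" "low_denominator ?n (\<rho> j) q" for t j p q
    unfolding X_def using point_far \<sigma> that by blast
  have approx: "X t \<in> approximable \<psi>" for t
  proof -
    define S where "S = {rat_point p q :: real ^ 'n | p q. 1 \<le> q \<and> max_dist (X t) (rat_point p q) < \<psi> q}"
    \<comment> \<open>\<open>X t\<close> has positive distance from every rational point, so a
      finite \<open>S\<close> would stay at distance \<open>\<delta>\<close>; a jump target in a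
      ball of radius below \<open>\<delta>\<close> contradicts this.\<close>
    have "infinite S"
    proof
      assume fin: "finite S"
      have pos: "0 < max_dist (X t) P" if PS: "P \<in> S" for P
      proof -
        obtain p q where pq: "P = rat_point p q" "1 \<le> q" using PS by (auto simp: S_def)
        obtain j where "low_denominator ?n (\<rho> j) q" using ex_low_denominator by blast
        then show ?thesis using far[OF pq(2), of j t p] pq(1) radius_pos[of j] by simp
      qed
      obtain \<delta> where \<delta>: "0 < \<delta>" "\<And>P. P \<in> S \<Longrightarrow> \<delta> \<le> max_dist (X t) P"
      proof (cases "S = {}")
        case False
        show ?thesis
        proof (rule that)
          show "0 < Min (max_dist (X t) ` S)" using fin False pos by simp
        qed (use fin in auto)
      qed (use that[of 1] in auto)
      have "eventually (\<lambda>j. \<rho> j < \<delta>) sequentially"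
        using radius_tendsto_0 \<delta>(1) by (rule order_tendstoD(2))
      then obtain j0 where j0: "\<And>j. j0 \<le> j \<Longrightarrow> \<rho> j < \<delta>" by (auto simp: eventually_sequentially)
      obtain j where j: "j0 \<le> j" "Suc j \<in> J" using sch(12) by blast
      obtain p q where pq: "1 \<le> q" "q \<le> A j ^ ?n" "max_dist (X t) (rat_point p q) \<le> \<rho> (Suc j)"
        using point_near_jump_target[of "\<sigma> t" j] \<sigma> j(2) unfolding X_def by metis
      \<comment> \<open>Monotonicity now gives \<open>\<psi> (Q j) \<le> \<psi> q\<close>, and the
        jump radius \<open>\<psi> (Q j) / 2\<close> makes the approximation strict.\<close>
      have "q \<le> Q j" using pq(2) sch(7)[OF j(2)] by simp
      then have "\<psi> (Q j) \<le> \<psi> q" "0 < \<psi> (Q j)" using antimono pq(1) approximation_function.pos[OF assms(1), of "Q j"] by auto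
      then have "max_dist (X t) (rat_point p q) < \<psi> q" using pq(3) sch(5)[OF j(2)] by linarith
      then have "rat_point p q \<in> S" using pq(1) by (auto simp: S_def)
      then show False using \<delta>(2) pq(3) j0[of "Suc j"] j(1) by force
    qed
    then show ?thesis by (simp add: approximable_def S_def)
  qed
  obtain K where K: "0 < K" "\<And>q r. \<lbrakk>1 \<le> q; 0 < r; \<not> low_denominator ?n r q\<rbrakk> \<Longrightarrow> \<psi> q \<le> K * r"
    using le_radius_of_high_denominator by metis
  \<comment> \<open>Let \<open>i\<close> be the first level at which \<open>q\<close> is low. If
    \<open>i\<close> is a jump level, \<open>\<psi> q \<le> C * \<psi> Q = 2 * C * \<rho> i\<close>;
    otherwise \<open>\<psi> q\<close> is at most \<open>K\<close> times the previous radius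
    \<open>16 * N * \<rho> i\<close>. The 4 in \<open>c\<close> comes from the distance
    \<open>\<rho> i / 4\<close> in \<open>far\<close>.\<close>
  define W where "W = 2 * C + 16 * N * K"
  define c where "c = 1 / (4 * W)"
  have W: "0 < W" using sch(10) K(1) unfolding W_def by (intro add_pos_nonneg) auto
  have c: "0 < c" using W by (simp add: c_def)
  have not_approx: "X t \<notin> approximable (\<lambda>q. c * \<psi> q)" for t
  proof -
    have "c * \<psi> q \<le> max_dist (X t) (rat_point p q)" if q: "1 \<le> q" for p q
    proof -
      define i where "i = (LEAST i. low_denominator ?n (\<rho> i) q)"
      have i: "low_denominator ?n (\<rho> i) q" unfolding i_def using ex_low_denominator by (rule LeastI_ex)
      obtain k where k: "i = Suc k" using i not_low_denominator_0[OF q] by (cases i) auto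
      have high: "\<not> low_denominator ?n (\<rho> k) q"
        using not_less_Least[of k "\<lambda>i. low_denominator ?n (\<rho> i) q"] k by (simp add: i_def)
      have "\<psi> q \<le> 2 * C * \<rho> i \<or> \<psi> q \<le> 16 * N * K * \<rho> i"
      proof (cases "Suc k \<in> J")
        case True
        have "\<psi> (Q k) = 2 * \<rho> i" using sch(5)[OF True] k by simp
        then show ?thesis using sch(11)[OF True q high] by simp
      next
        case False
        then show ?thesis using K(2)[OF q radius_pos high] radius_step[OF False] k branching(1) by simp
      qed
      moreover have "0 \<le> C * \<rho> i" "0 \<le> N * K * \<rho> i" using radius_pos[of i] sch(10) K(1) by simp_all
      ultimately have "\<psi> q \<le> W * \<rho> i" by (auto simp: W_def algebra_simps)
      then have "c * \<psi> q \<le> c * (W * \<rho> i)" using c by (intro mult_left_mono) auto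
      also have "\<dots> = \<rho> i / 4" using W by (simp add: c_def)
      also have "\<dots> \<le> max_dist (X t) (rat_point p q)" using far[OF q i] .
      finally show ?thesis .
    qed
    then have "{rat_point p q | p q. 1 \<le> q \<and> max_dist (X t) (rat_point p q) < c * \<psi> q} = {}"
      by (auto simp: not_less)
    then show ?thesis by (simp add: approximable_def del: Collect_empty_eq)
  qed
  show ?thesis
  proof (rule hausdorff_measure_pos[of u "(8 * real N) powr u" X])
    show "X t \<in> badly_approximable \<psi>" for t
      using approx not_approx c by (auto simp: badly_approximable_def)
    fix t t' :: real
    assume t: "t \<in> {0..<1}" "t' \<in> {0..<1}" "t \<noteq> t'"
    obtain j where j: "\<And>i. i < j \<Longrightarrow> nat \<lfloor>t * real M ^ Suc i\<rfloor> mod M = nat \<lfloor>t' * real M ^ Suc i\<rfloor> mod M"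
      "nat \<lfloor>t * real M ^ Suc j\<rfloor> mod M \<noteq> nat \<lfloor>t' * real M ^ Suc j\<rfloor> mod M"
      "\<bar>t - t'\<bar> \<le> 1 / real M ^ j"
      using first_differing_digit[OF M t] by metis
    have "\<sigma> t j \<noteq> \<sigma> t' j"
      unfolding \<sigma>_def using j(2) M inj_onD[OF bij_betw_imp_inj_on[OF v]] by force
    then have sep: "\<rho> j / (8 * N) \<le> max_dist (X t) (X t')"
      unfolding X_def using point_separated[of "\<sigma> t" "\<sigma> t'" j] \<sigma> j(1) by (auto simp: \<sigma>_def)
    have "0 < \<rho> j / (8 * N)" using radius_pos[of j] branching(1) by simp
    with sep have pos: "0 < max_dist (X t) (X t')" by linarith
    have "\<bar>t - t'\<bar> \<le> \<rho> j powr u" using j(3) sch(13)[of j] by (simp add: M_def)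
    also have "\<dots> \<le> (8 * real N * max_dist (X t) (X t')) powr u"
      using sep u radius_pos[of j] branching(1) by (intro powr_mono2) (auto simp: field_simps)
    also have "\<dots> = (8 * real N) powr u * max_dist (X t) (X t') powr u"
      by (rule powr_mult)
    finally show "max_dist (X t) (X t') \<noteq> 0 \<and> \<bar>t - t'\<bar> \<le> (8 * real N) powr u * max_dist (X t) (X t') powr u"
      using pos by simp
  qed (use u branching(1) in auto)
qed

section \<open>Upper bound for approximable points\<close>

text \<open>The Hausdorff-Cantelli argument: each tail of the family covers \<open>E\<close>, and
  its sum of \<open>s\<close>-th powers of diameters is bounded by a tail of a convergent
  series.\<close>

lemma hausdorff_measure_0_limsup_cover:
  fixes U :: "nat \<Rightarrow> 'b \<Rightarrow> 'a set" and w :: "nat \<Rightarrow> real"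
  assumes s: "0 < s" and fin: "\<And>q. finite (P q)"
    and sum: "summable (\<lambda>q. real (card (P q)) * w q powr s)"
    and w: "\<And>q. 0 \<le> w q" "w \<longlonglongrightarrow> 0"
    and small: "\<And>q p x y. \<lbrakk>1 \<le> q; p \<in> P q; x \<in> U q p; y \<in> U q p\<rbrakk> \<Longrightarrow> d x y \<le> w q"
    and dpos: "\<And>x y. 0 \<le> d x y"
    and cover: "\<And>x. x \<in> E \<Longrightarrow> \<exists>\<^sub>F q in sequentially. \<exists>p\<in>P q. x \<in> U q p"
  shows "hausdorff_measure d s E = 0"
proof -
  define g where "g = (\<lambda>q. real (card (P q)) * w q powr s)"
  have g0: "0 \<le> g q" for q by (simp add: g_def)
  have summable: "summable g" unfolding g_def by (rule sum)
  have main: "hausdorff_premeasure d s \<delta> E \<le> ennreal \<epsilon>" if \<delta>: "0 < \<delta>" and \<epsilon>: "0 < \<epsilon>" for \<delta> \<epsilon>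
  proof -
    have "eventually (\<lambda>q. w q < \<delta>) sequentially" using w(2) \<delta> by (rule order_tendstoD(2))
    then obtain q1 where q1: "\<And>q. q1 \<le> q \<Longrightarrow> w q < \<delta>" by (auto simp: eventually_sequentially)
    have "(\<lambda>k. suminf (\<lambda>i. g (i + k))) \<longlonglongrightarrow> 0"
      using suminf_exist_split2[of g] sum by (simp add: g_def)
    then have "eventually (\<lambda>k. (\<Sum>i. g (i + k)) < \<epsilon>) sequentially"
      using \<epsilon> by (intro order_tendstoD(2))
    then obtain q2 where q2: "\<And>k. q2 \<le> k \<Longrightarrow> (\<Sum>i. g (i + k)) < \<epsilon>"
      by (auto simp: eventually_sequentially)
    define q0 where "q0 = max 1 (max q1 q2)"
    have q20: "q2 \<le> q0" by (simp add: q0_def)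
    define I where "I = (SIGMA q:{q0..}. P q)"
    have "countable I" unfolding I_def by (intro countable_SIGMA countableI_type countable_finite fin)
    define e where "e = to_nat_on I"
    have e: "inj_on e I" unfolding e_def using \<open>countable I\<close> by (rule inj_on_to_nat_on)
    define V where "V = (\<lambda>k. if k \<in> e ` I then (case the_inv_into I e k of (q, p) \<Rightarrow> U q p) else {})"
    have V: "V (e (q, p)) = U q p" if "(q, p) \<in> I" for q p
      using that by (simp add: V_def the_inv_into_f_f[OF e])
    have V': "V k = {}" if "k \<notin> e ` I" for k using that by (simp add: V_def)
    have pw: "diam_pow d s (U q p) \<le> w q powr s" if "(q, p) \<in> I" for q p
    proof (cases "U q p = {}")
      case False
      have qp: "1 \<le> q" "p \<in> P q" using that by (auto simp: I_def q0_def)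
      obtain x where x: "x \<in> U q p" using False by blast
      have "0 \<le> diam d (U q p)"
        using order_trans[OF dpos le_diam[of "U q p" d "w q" x x]] small[OF qp] x by blast
      moreover have "diam d (U q p) \<le> w q" using False small[OF qp] by (intro diam_le) auto
      ultimately show ?thesis using False s by (auto simp: diam_pow_def intro!: powr_mono2)
    qed (simp add: diam_pow_def)
    have dp0: "0 \<le> diam_pow d s B" for B by (simp add: diam_pow_def)
    have "V \<in> delta_covers d \<delta> E"
    proof -
      have "x \<in> (\<Union>k. V k)" if "x \<in> E" for x
      proof -
        have "\<exists>q\<ge>q0. \<exists>p\<in>P q. x \<in> U q p"
          using cover[OF that] unfolding frequently_sequentially by blast
        then obtain q p where "(q, p) \<in> I" "x \<in> U q p" by (auto simp: I_def)
        then show ?thesis using V by blast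
      qed
      moreover have "d x y \<le> \<delta>" if xy: "x \<in> V k" "y \<in> V k" for x y k
      proof -
        obtain q p where qp: "(q, p) \<in> I" "k = e (q, p)" using V'[of k] xy(1) by force
        then have "d x y \<le> w q"
          using small[of q p x y] xy V[OF qp(1)] by (auto simp: I_def q0_def)
        moreover have "q1 \<le> q" using qp(1) by (simp add: I_def q0_def)
        ultimately show ?thesis using q1 by force
      qed
      ultimately show ?thesis by (auto simp: delta_covers_def)
    qed
    then have "hausdorff_premeasure d s \<delta> E \<le> (\<Sum>k. ennreal (diam_pow d s (V k)))"
      unfolding hausdorff_premeasure_def by (rule INF_lower)
    also have "\<dots> \<le> ennreal \<epsilon>"
    proof (rule suminf_le_const[OF summableI])
      fix m
      define F where "F = {i \<in> I. e i < m}"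
      have "finite (e ` F)" by (rule finite_subset[of _ "{..<m}"]) (auto simp: F_def)
      then have finF: "finite F" by (rule finite_imageD) (use e in \<open>auto simp: F_def inj_on_def\<close>)
      have injF: "inj_on e F" using e by (auto simp: F_def inj_on_def)
      \<comment> \<open>Only finitely many pairs have numbers below \<open>m\<close>; they all have
        \<open>q\<close> below \<open>L\<close>, so the partial sum is bounded by a finite segment
        of \<open>g\<close>.\<close>
      define L where "L = Suc (Max (insert q0 (fst ` F)))"
      have L: "q < L" if "(q, p) \<in> F" for q p
      proof -
        have "q \<in> fst ` F" using that by (rule rev_image_eqI) simp
        then have "q \<le> Max (insert q0 (fst ` F))" using finF by (intro Max_ge) simp_all
        then show ?thesis by (simp add: L_def)
      qed
      have q0L: "q0 \<le> L"
      proof -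
        have "q0 \<le> Max (insert q0 (fst ` F))" using finF by (intro Max_ge) auto
        then show ?thesis by (simp add: L_def)
      qed
      have "(\<Sum>k<m. diam_pow d s (V k)) = (\<Sum>k\<in>e ` F. diam_pow d s (V k))"
      proof (rule sum.mono_neutral_right)
        show "\<forall>k\<in>{..<m} - e ` F. diam_pow d s (V k) = 0"
        proof
          fix k assume "k \<in> {..<m} - e ` F"
          then have "k \<notin> e ` I" by (auto simp: F_def)
          then show "diam_pow d s (V k) = 0" by (simp add: V' diam_pow_def)
        qed
      qed (auto simp: F_def)
      also have "\<dots> = (\<Sum>i\<in>F. diam_pow d s (V (e i)))" by (simp add: sum.reindex injF)
      also have "\<dots> \<le> (\<Sum>(q, p)\<in>F. w q powr s)"
      proof (rule sum_mono)
        fix i assume "i \<in> F"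
        then show "diam_pow d s (V (e i)) \<le> (case i of (q, p) \<Rightarrow> w q powr s)"
          using pw V by (cases i) (auto simp: F_def)
      qed
      also have "\<dots> \<le> (\<Sum>(q, p)\<in>(SIGMA q:{q0..<L}. P q). w q powr s)"
      proof (rule sum_mono2)
        show "F \<subseteq> (SIGMA q:{q0..<L}. P q)" using L by (auto simp: F_def I_def)
      qed (use fin in auto)
      also have "\<dots> = (\<Sum>q\<in>{q0..<L}. g q)"
        using fin by (subst sum.Sigma[symmetric]) (auto simp: g_def)
      also have "\<dots> = (\<Sum>i<L - q0. g (i + q0))"
        using q0L sum.shift_bounds_nat_ivl[of g 0 q0 "L - q0"] by (simp add: atLeast0LessThan)
      also have "\<dots> \<le> (\<Sum>i. g (i + q0))"
        using summable g0 by (intro sum_le_suminf) (simp_all add: summable_iff_shift)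
      also have "\<dots> \<le> \<epsilon>" using less_imp_le[OF q2[OF q20]] .
      finally have "(\<Sum>k<m. diam_pow d s (V k)) \<le> \<epsilon>" .
      then show "(\<Sum>k<m. ennreal (diam_pow d s (V k))) \<le> ennreal \<epsilon>"
        using dp0 by (simp add: sum_ennreal ennreal_leI)
    qed
    finally show ?thesis .
  qed
  have "hausdorff_premeasure d s \<delta> E \<le> 0" if "0 < \<delta>" for \<delta>
    by (rule ennreal_le_epsilon) (use main that in simp)
  then have "hausdorff_measure d s E \<le> 0"
    unfolding hausdorff_measure_def by (intro SUP_least) simp
  then show ?thesis by simp
qed

lemma int_vec_box:
  shows finite_int_vec_box: "finite {p :: int ^ 'n. \<forall>i. \<bar>p $ i\<bar> \<le> m}"
    and card_int_vec_box_le: "0 \<le> m \<Longrightarrow> real (card {p :: int ^ 'n. \<forall>i. \<bar>p $ i\<bar> \<le> m}) \<le> (2 * real_of_int m + 1) ^ CARD('n)"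
proof -
  define B where "B = (UNIV :: 'n set) \<rightarrow>\<^sub>E {-m..m}"
  have B: "finite B" by (simp add: B_def finite_PiE)
  have sub: "{p :: int ^ 'n. \<forall>i. \<bar>p $ i\<bar> \<le> m} \<subseteq> vec_lambda ` B"
  proof
    fix p :: "int ^ 'n" assume "p \<in> {p. \<forall>i. \<bar>p $ i\<bar> \<le> m}"
    then have "vec_nth p \<in> B" by (auto simp: B_def abs_le_iff minus_le_iff)
    then show "p \<in> vec_lambda ` B" by (metis image_eqI vec_nth_inverse)
  qed
  then show "finite {p :: int ^ 'n. \<forall>i. \<bar>p $ i\<bar> \<le> m}" using B finite_surj by blast
  assume m: "0 \<le> m"
  have "card {p :: int ^ 'n. \<forall>i. \<bar>p $ i\<bar> \<le> m} \<le> card B"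
    using sub B by (rule surj_card_le[rotated])
  then have "real (card {p :: int ^ 'n. \<forall>i. \<bar>p $ i\<bar> \<le> m}) \<le> real (card B)" by simp
  also have "\<dots> = (2 * real_of_int m + 1) ^ CARD('n)"
    using m by (simp add: B_def card_funcsetE)
  finally show "real (card {p :: int ^ 'n. \<forall>i. \<bar>p $ i\<bar> \<le> m}) \<le> (2 * real_of_int m + 1) ^ CARD('n)" .
qed

text \<open>The natural cover by balls of radius \<open>\<psi> q\<close> around
  \<open>p / q\<close>. As the set is not confined to a bounded region, the numerators range over
  boxes of size about \<open>q powr (1 + \<eta>)\<close>, which for each point eventually contain
  all that matter, while the gap between \<open>s\<close> and \<open>s'\<close> pays for the extra
  \<open>\<eta>\<close>.\<close>

lemma hausdorff_measure_approximable_0: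
  fixes \<psi> :: "nat \<Rightarrow> real"
  assumes pos: "\<And>q. 1 \<le> q \<Longrightarrow> 0 < \<psi> q" and s: "0 < s" "s < s'"
    and bounded: "\<And>q. 1 \<le> q \<Longrightarrow> real q ^ Suc CARD('n) * \<psi> q powr s \<le> C"
  shows "hausdorff_measure max_dist s' (approximable \<psi> :: (real ^ 'n) set) = 0"
proof -
  define n where "n = CARD('n)"
  define n' where "n' = real (Suc n)"
  define \<tau> where "\<tau> = s' / s"
  have n: "1 \<le> n" "0 < n'" "n' = real n + 1" by (simp_all add: n_def n'_def)
  have \<tau>: "1 < \<tau>" using s by (simp add: \<tau>_def)
  \<comment> \<open>With this value the exponent \<open>\<gamma>\<close> of the comparison series
    equals \<open>- 1 - n' * (\<tau> - 1) / 2\<close>, which is below \<open>- 1\<close>.\<close>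
  define \<eta> where "\<eta> = n' * (\<tau> - 1) / (2 * real n)"
  have \<eta>: "0 < \<eta>" unfolding \<eta>_def using n \<tau> by (intro divide_pos_pos mult_pos_pos) auto
  have C0: "0 \<le> C" using bounded[of 1] by (metis order_trans order_refl mult_nonneg_nonneg of_nat_0_le_iff powr_ge_zero zero_le_power)
  have \<psi>s: "\<psi> q powr s \<le> C * real q powr (- n')" if q: "1 \<le> q" for q
  proof -
    have "real q ^ Suc n = real q powr n'" using q by (simp add: n'_def powr_realpow del: of_nat_Suc power_Suc)
    then have "real q powr n' * \<psi> q powr s \<le> C" using bounded[OF q] by (simp add: n_def)
    then show ?thesis using q by (simp add: powr_minus field_simps)
  qed
  \<comment> \<open>The value at 0 is set separately because \<open>\<psi> 0\<close> may be
    negative.\<close>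
  define w where "w = (\<lambda>q. if q = 0 then 0 else 2 * \<psi> q)"
  define m where "m = (\<lambda>q. \<lceil>real q powr (1 + \<eta>)\<rceil>)"
  define P :: "nat \<Rightarrow> (int ^ 'n) set" where "P = (\<lambda>q. {p. \<forall>i. \<bar>p $ i\<bar> \<le> m q})"
  define U where "U = (\<lambda>q (p :: int ^ 'n). {y. max_dist y (rat_point p q) < \<psi> q})"
  have w0: "0 \<le> w q" for q using pos[of q] by (auto simp: w_def intro: less_imp_le)
  have "(\<lambda>q. (C * real q powr (- n')) powr (1 / s)) \<longlonglongrightarrow> 0"
  proof -
    have "(\<lambda>q. C * real q powr (- n')) \<longlonglongrightarrow> C * 0"
      using n by (intro tendsto_intros tendsto_neg_powr filterlim_real_sequentially) auto
    then have "(\<lambda>q. (C * real q powr (- n')) powr (1 / s)) \<longlonglongrightarrow> 0 powr (1 / s)"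
      using s C0 by (intro tendsto_powr2 tendsto_const) auto
    then show ?thesis by simp
  qed
  then have lim: "(\<lambda>q. 2 * (C * real q powr (- n')) powr (1 / s)) \<longlonglongrightarrow> 0"
    by (rule tendsto_mult_right_zero)
  have w_lim: "w \<longlonglongrightarrow> 0"
  proof (rule tendsto_sandwich[OF _ _ tendsto_const lim])
    show "\<forall>\<^sub>F q in sequentially. 0 \<le> w q" using w0 by simp
    show "\<forall>\<^sub>F q in sequentially. w q \<le> 2 * (C * real q powr (- n')) powr (1 / s)"
      using eventually_ge_at_top[of 1]
    proof eventually_elim
      case (elim q)
      have "\<psi> q = (\<psi> q powr s) powr (1 / s)" using pos[OF elim] s by (simp add: powr_powr)
      also have "\<dots> \<le> (C * real q powr (- n')) powr (1 / s)"
        using \<psi>s[OF elim] s by (intro powr_mono2) auto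
      finally show ?case using elim by (simp add: w_def)
    qed
  qed
  have summable: "summable (\<lambda>q. real (card (P q)) * w q powr s')"
  proof (rule summable_comparison_test_ev)
    define K where "K = 5 ^ n * (2 powr s' * C powr \<tau>)"
    define \<gamma> where "\<gamma> = (1 + \<eta>) * real n - n' * \<tau>"
    have "\<eta> * real n = n' * (\<tau> - 1) / 2" using n by (simp add: \<eta>_def)
    moreover have "\<gamma> = real n + \<eta> * real n - n' * \<tau>" by (simp add: \<gamma>_def algebra_simps)
    moreover have "n' * (\<tau> - 1) = n' * \<tau> - n'" by (simp add: algebra_simps)
    ultimately have "\<gamma> = -1 - n' * (\<tau> - 1) / 2" using n(3) by linarith
    moreover have "0 < n' * (\<tau> - 1)" using n \<tau> by simp
    ultimately have "\<gamma> < -1" by simp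
    then show "summable (\<lambda>q. K * real q powr \<gamma>)"
      by (intro summable_mult) (simp add: summable_real_powr_iff)
    show "\<forall>\<^sub>F q in sequentially. norm (real (card (P q)) * w q powr s') \<le> K * real q powr \<gamma>"
      using eventually_ge_at_top[of 1]
    proof eventually_elim
      case (elim q)
      have q: "0 < real q" using elim by simp
      have ge1: "1 \<le> real q powr (1 + \<eta>)" using elim \<eta> by (intro ge_one_powr_ge_zero) auto
      have "real_of_int (m q) \<le> real q powr (1 + \<eta>) + 1" unfolding m_def by linarith
      then have "2 * real_of_int (m q) + 1 \<le> 5 * real q powr (1 + \<eta>)" using ge1 by linarith
      moreover have m0: "0 \<le> m q" unfolding m_def using ge1 by linarith
      ultimately have "real (card (P q)) \<le> (5 * real q powr (1 + \<eta>)) ^ n"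
        unfolding P_def n_def by (intro order_trans[OF card_int_vec_box_le] power_mono) auto
      also have "\<dots> = 5 ^ n * real q powr ((1 + \<eta>) * real n)"
        using q by (simp add: power_mult_distrib powr_powr flip: powr_realpow)
      finally have 1: "real (card (P q)) \<le> 5 ^ n * real q powr ((1 + \<eta>) * real n)" .
      have "w q powr s' = 2 powr s' * (\<psi> q powr s) powr \<tau>"
        using elim pos[OF elim] s by (simp add: w_def powr_mult powr_powr \<tau>_def)
      also have "\<dots> \<le> 2 powr s' * (C * real q powr (- n')) powr \<tau>"
        using \<psi>s[OF elim] \<tau> by (intro mult_left_mono powr_mono2) auto
      also have "\<dots> = 2 powr s' * C powr \<tau> * real q powr (- (n' * \<tau>))"
        using C0 by (simp add: powr_mult powr_powr)
      finally have 2: "w q powr s' \<le> 2 powr s' * C powr \<tau> * real q powr (- (n' * \<tau>))" .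
      have "real (card (P q)) * w q powr s'
          \<le> (5 ^ n * real q powr ((1 + \<eta>) * real n)) * (2 powr s' * C powr \<tau> * real q powr (- (n' * \<tau>)))"
        using 1 2 by (intro mult_mono) auto
      also have "\<dots> = K * real q powr \<gamma>"
        by (simp add: K_def \<gamma>_def powr_diff powr_minus field_simps)
      finally show ?case by simp
    qed
  qed
  show ?thesis
  proof (rule hausdorff_measure_0_limsup_cover[where P = P and U = U and w = w])
    show "0 < s'" using s by simp
    show "finite (P q)" for q unfolding P_def by (rule finite_int_vec_box)
    show "max_dist x y \<le> w q" if "1 \<le> q" "p \<in> P q" "x \<in> U q p" "y \<in> U q p" for q p x y
      using that max_dist_triangle[of x y "rat_point p q"] max_dist_commute[of y "rat_point p q"]
      by (simp add: U_def w_def)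
    fix x :: "real ^ 'n" assume x: "x \<in> approximable \<psi>"
    show "\<exists>\<^sub>F q in sequentially. \<exists>p\<in>P q. x \<in> U q p"
    \<comment> \<open>Otherwise, from some \<open>q0\<close> on, no \<open>p / q\<close> at all is
      within \<open>\<psi> q\<close> of \<open>x\<close>, since for large \<open>q\<close> such a
      \<open>p\<close> lies in the box \<open>P q\<close>. Each smaller \<open>q\<close> admits only
      finitely many \<open>p\<close>, so \<open>x\<close> would have finitely many approximating
      points.\<close>
    proof (rule ccontr)
      assume "\<not> ?thesis"
      then have ev: "\<forall>\<^sub>F q in sequentially. \<forall>p\<in>P q. x \<notin> U q p"
        by (simp add: not_frequently)
      have "\<forall>\<^sub>F q in sequentially. max_dist x 0 + 1 \<le> real q powr \<eta>"
        using powr_mult_le_eventually[OF \<eta> zero_less_one, of "max_dist x 0 + 1"] eventually_ge_at_top[of 1]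
        by eventually_elim (simp add: powr_minus field_simps)
      moreover have "\<forall>\<^sub>F q in sequentially. w q < 1"
        using w_lim by (rule order_tendstoD(2)) simp
      ultimately have "\<forall>\<^sub>F q in sequentially. \<forall>p. \<not> max_dist x (rat_point p q) < \<psi> q"
        using ev eventually_ge_at_top[of 1]
      proof eventually_elim
        case (elim q)
        show ?case
        proof (intro allI notI)
          fix p assume near: "max_dist x (rat_point p q) < \<psi> q"
          have \<psi>1: "\<psi> q < 1" using elim pos[of q] by (simp add: w_def)
          have "\<bar>p $ i\<bar> \<le> m q" for i
          proof -
            have "\<bar>rat_point p q $ i - 0 $ i\<bar> \<le> max_dist x (rat_point p q) + max_dist x 0"
              using component_le_max_dist[of "rat_point p q" i 0] max_dist_triangle[of "rat_point p q" 0 x]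
                max_dist_commute[of x "rat_point p q"] by linarith
            also have "\<dots> \<le> real q powr \<eta>" using near \<psi>1 elim(1) by linarith
            finally have "real_of_int \<bar>p $ i\<bar> \<le> real q * real q powr \<eta>"
              using elim(4) by (simp add: field_simps)
            also have "\<dots> = real q powr (1 + \<eta>)" using elim(4) by (simp add: powr_add)
            finally show ?thesis unfolding m_def by linarith
          qed
          then have "p \<in> P q" by (simp add: P_def)
          then show False using elim(3) near by (auto simp: U_def)
        qed
      qed
      then obtain q0 where q0: "\<And>q p. q0 \<le> q \<Longrightarrow> \<not> max_dist x (rat_point p q) < \<psi> q"
        by (auto simp: eventually_sequentially)
      have "{rat_point p q | p q. 1 \<le> q \<and> max_dist x (rat_point p q) < \<psi> q}
          \<subseteq> (\<Union>q\<in>{1..<q0}. (\<lambda>p. rat_point p q) ` {p. \<forall>i. \<bar>p $ i\<bar> \<le> \<lceil>real q * (max_dist x 0 + \<psi> q)\<rceil>})"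
      proof clarify
        fix p q assume q: "1 \<le> q" and near: "max_dist x (rat_point p q) < \<psi> q"
        have "\<bar>p $ i\<bar> \<le> \<lceil>real q * (max_dist x 0 + \<psi> q)\<rceil>" for i
        proof -
          have "\<bar>rat_point p q $ i - 0 $ i\<bar> \<le> max_dist x (rat_point p q) + max_dist x 0"
            using component_le_max_dist[of "rat_point p q" i 0] max_dist_triangle[of "rat_point p q" 0 x]
              max_dist_commute[of x "rat_point p q"] by linarith
          also have "\<dots> \<le> max_dist x 0 + \<psi> q" using near by linarith
          finally have "real_of_int \<bar>p $ i\<bar> \<le> real q * (max_dist x 0 + \<psi> q)"
            using q by (simp add: field_simps)
          then show ?thesis by linarith
        qed
        moreover have "q < q0" using q0[of q p] near by (meson not_le)
        ultimately show "rat_point p q \<in> (\<Union>q\<in>{1..<q0}. (\<lambda>p. rat_point p q) ` {p. \<forall>i. \<bar>p $ i\<bar> \<le> \<lceil>real q * (max_dist x 0 + \<psi> q)\<rceil>})"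
          using q by (intro UN_I[of q] imageI) auto
      qed
      then have "finite {rat_point p q | p q. 1 \<le> q \<and> max_dist x (rat_point p q) < \<psi> q}"
        by (rule finite_subset) (simp add: finite_int_vec_box)
      then show False using x by (simp add: approximable_def)
    qed
  qed (use w0 w_lim summable in auto)
qed

section \<open>Equality of the two Hausdorff dimensions\<close>

theorem corollary1:
  fixes \<psi> :: "nat \<Rightarrow> real"
  assumes "\<And>q. 1 \<le> q \<Longrightarrow> 0 < \<psi> q"
    and "\<And>q r. 1 \<le> q \<Longrightarrow> q \<le> r \<Longrightarrow> \<psi> r \<le> \<psi> q"
    and "\<psi> \<in> o(\<lambda>s. real s powr (- ((real CARD('n) + 1) / real CARD('n))))"
  shows "hausdorff_dim max_dist (badly_approximable \<psi> :: (real ^ 'n::finite) set) =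
         hausdorff_dim max_dist (approximable \<psi> :: (real ^ 'n) set)"
proof (rule antisym)
  let ?n = "CARD('n)"
  let ?B = "badly_approximable \<psi> :: (real ^ 'n) set"
  let ?W = "approximable \<psi> :: (real ^ 'n) set"
  show "hausdorff_dim max_dist ?B \<le> hausdorff_dim max_dist ?W"
    by (intro hausdorff_dim_mono) (auto simp: badly_approximable_def)
  show "hausdorff_dim max_dist ?W \<le> hausdorff_dim max_dist ?B"
  proof (rule ccontr)
    assume "\<not> ?thesis"
    then obtain u where u: "0 \<le> u" "hausdorff_measure max_dist u ?B = 0" "ennreal u < hausdorff_dim max_dist ?W"
      unfolding not_le hausdorff_dim_def[of _ ?B] INF_less_iff by auto
    have between: "\<exists>s. r < s \<and> ennreal s < hausdorff_dim max_dist ?W"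
      if r: "ennreal r < hausdorff_dim max_dist ?W" "0 \<le> r" for r
    proof -
      obtain z where "ennreal r < z" "z < hausdorff_dim max_dist ?W"
        using dense[OF r(1)] by blast
      then show ?thesis using r(2) by (cases z) (auto simp: ennreal_less_iff)
    qed
    \<comment> \<open>Two intermediate exponents are inserted: the gap between \<open>s\<close> and
      \<open>s'\<close> makes the natural cover converge, and the gap between \<open>u\<close> and
      \<open>s\<close> leaves room for the Cantor set.\<close>
    obtain s where s: "u < s" "ennreal s < hausdorff_dim max_dist ?W" using between u by blast
    obtain s' where s': "s < s'" "ennreal s' < hausdorff_dim max_dist ?W"
      using between[OF s(2)] s u by auto
    have unbounded: "\<exists>q\<ge>1. C < real q ^ Suc ?n * \<psi> q powr s" for C
    proof (rule ccontr)
      assume "\<not> ?thesis"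
      then have "\<And>q. 1 \<le> q \<Longrightarrow> real q ^ Suc ?n * \<psi> q powr s \<le> C" by (meson not_le)
      then have "hausdorff_measure max_dist s' ?W = 0"
        using assms(1) s s' u by (intro hausdorff_measure_approximable_0[of \<psi> s s' C]) auto
      then have "hausdorff_dim max_dist ?W \<le> ennreal s'"
        using s s' u by (intro hausdorff_dim_le) auto
      then show False using s'(2) by simp
    qed
    have "\<forall>\<^sub>F q in sequentially. \<psi> q ^ ?n * real q ^ Suc ?n \<le> 1"
      using landau_o.smallD[OF assms(3) zero_less_one] eventually_ge_at_top[of 1]
    proof eventually_elim
      case (elim q)
      have "\<psi> q \<le> real q powr (- ((real ?n + 1) / real ?n))"
        using elim by simp
      then have "\<psi> q ^ ?n \<le> (real q powr (- ((real ?n + 1) / real ?n))) ^ ?n"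
        using assms(1)[OF elim(2)] by (intro power_mono) auto
      also have "\<dots> = real q powr (- ((real ?n + 1) / real ?n) * real ?n)"
        using elim by (subst powr_realpow[symmetric], simp, simp only: powr_powr)
      also have "- ((real ?n + 1) / real ?n) * real ?n = - real (Suc ?n)"
        by (simp add: field_simps)
      finally have "\<psi> q ^ ?n * real q ^ Suc ?n \<le> real q powr (- real (Suc ?n)) * real q powr real (Suc ?n)"
        using elim by (subst powr_realpow) (auto intro!: mult_right_mono)
      also have "\<dots> = 1" using elim by (simp flip: powr_add)
      finally show ?case .
    qed
    then have "approximation_function \<psi> ?n s"
      using assms(1,2) unbounded s u by unfold_locales auto
    then show False using hausdorff_measure_badly_approximable_pos u(1) s(1) u(2) by blast
  qed
qed

end
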